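(* Let $n\ge 3$ and let $\Omega\subset\mathbb{R}^n$ be a domain with $|\Omega|<+\infty$. Let $\mathbf{A}$ be bounded and uniformly elliptic with constant $\lambda>0$, let $\boldsymbol{b},\boldsymbol{c}\in L^n(\Omega)$, $\boldsymbol{b}-\boldsymbol{c}\in L^p(\Omega)$ for some $p>n$, $d\in L^{n/2}(\Omega)$, and $d\ge\operatorname{div}\boldsymbol{b}$ in the sense of distributions. Let $G(x,y)$ be Green's function for the equation $Lu=0$ in $\Omega$ and $g(y,x)$ be Green's function for the equation $L^{\mathsf T}u=0$ in $\Omega$. Then \[ G(x,y)=g(y,x) \] for almost all $x,y\in\Omega$ with $x\ne y$.
   Context: A domain is an open connected set. $\mathbf{A}=(a^{ij})$ is a measurable $n\times n$ matrix function on $\Omega$; uniform ellipticity with constant $\lambda$ means $\lambda|\boldsymbol\xi|^2\le \mathbf{A}(x)\boldsymbol\xi\cdot\boldsymbol\xi$ for all $x\in\Omega$, $\boldsymbol\xi\in\mathbb{R}^n$. The condition $d\ge\operatorname{div}\boldsymbol b$ means $\int_\Omega d\phi+\boldsymbol b\cdot\nabla\phi\ge 0$ for all $0\le \phi\in C_c^\infty(\Omega)$. Let $Lu=-\operatorname{div}(\mathbf{A}\nabla u+\boldsymbol{b}u)+\boldsymbol{c}\cdot\nabla u+du$ and $L^{\mathsf T}u=-\operatorname{div}(\mathbf{A}^{\mathsf T}\nabla u+\boldsymbol{c}u)+\boldsymbol{b}\cdot\nabla u+du$. For $\phi\in L^\infty(\Omega)$, let $T\phi\in W_0^{1,2}(\Omega)$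 be the unique weak solution $u$ of $Lu=\phi$, i.e. $\int_\Omega \mathbf{A}\nabla u\cdot\nabla\psi+\boldsymbol{b}\cdot\nabla\psi\,u+\boldsymbol{c}\cdot\nabla u\,\psi+du\psi=\int_\Omega\phi\psi$ for all $\psi\in C_c^\infty(\Omega)$, and let $S\phi\in W_0^{1,2}(\Omega)$ be the unique weak solution of $L^{\mathsf T}u=\phi$, defined analogously (both exist under the stated hypotheses). Green's function for $Lu=0$ in $\Omega$ is a function $G(x,y)=G_y(x)$ with $G_y\in L^1(\Omega)$ for a.e. $y$ and, for every $\phi\in L^\infty(\Omega)$, $S\phi(y)=\int_\Omega G(x,y)\phi(x)\,dx$ for a.e. $y\in\Omega$. Green's function for $L^{\mathsf T}u=0$ in $\Omega$ is a function $g(y,x)=g_x(y)$ with $g_x\in L^1(\Omega)$ for a.e. $x$ and, for every $\phi\in L^\infty(\Omega)$, $T\phi(x)=\int_\Omega g(y,x)\phi(y)\,dy$ for a.e. $x\in\Omega$. Under the stated hypotheses both exist, and they are unique up to null sets. *)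

theory Defs
  imports "HOL-Analysis.Analysis"
begin

section \<open>Test functions\<close>

definition grad :: "(real^'n \<Rightarrow> real) \<Rightarrow> real^'n \<Rightarrow> real^'n" where
  "grad f x = (\<chi> i. frechet_derivative f (at x) (axis i 1))"

primrec C_k :: "nat \<Rightarrow> (real^'n \<Rightarrow> real) \<Rightarrow> bool" where
  "C_k 0 f \<longleftrightarrow> continuous_on UNIV f"
| "C_k (Suc k) f \<longleftrightarrow> (\<forall>x. f differentiable (at x)) \<and> (\<forall>i. C_k k (\<lambda>x. grad f x $ i))"

definition test_function :: "(real^'n) set \<Rightarrow> (real^'n \<Rightarrow> real) \<Rightarrow> bool" where
  "test_function \<Omega> \<phi> \<longleftrightarrow> (\<forall>k. C_k k \<phi>) \<and>
     compact (closure {x. \<phi> x \<noteq> 0}) \<and> closure {x. \<phi> x \<noteq> 0} \<subseteq> \<Omega>"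

section \<open>Lebesgue and Sobolev spaces\<close>

text \<open>Functions on \<open>\<Omega>\<close> are represented by total functions whose values off \<open>\<Omega>\<close> are never used.\<close>

definition Lp_on :: "(real^'n) set \<Rightarrow> real \<Rightarrow> (real^'n \<Rightarrow> 'b::euclidean_space) \<Rightarrow> bool" where
  "Lp_on \<Omega> p f \<longleftrightarrow> f \<in> borel_measurable (lebesgue_on \<Omega>) \<and>
     integrable (lebesgue_on \<Omega>) (\<lambda>x. norm (f x) powr p)"

definition Linf_on :: "(real^'n) set \<Rightarrow> (real^'n \<Rightarrow> real) \<Rightarrow> bool" where
  "Linf_on \<Omega> f \<longleftrightarrow> f \<in> borel_measurable (lebesgue_on \<Omega>) \<and>
     (\<exists>C. AE x in lebesgue_on \<Omega>. \<bar>f x\<bar> \<le> C)"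

text \<open>\<open>W12 \<Omega> u Du\<close>: \<open>u\<close> belongs to \<open>W\<^sup>1\<^sup>,\<^sup>2(\<Omega>)\<close> and \<open>Du\<close> is its weak gradient
  (determined by \<open>u\<close> up to a null set).\<close>

definition W12 :: "(real^'n) set \<Rightarrow> (real^'n \<Rightarrow> real) \<Rightarrow> (real^'n \<Rightarrow> real^'n) \<Rightarrow> bool" where
  "W12 \<Omega> u Du \<longleftrightarrow> Lp_on \<Omega> 2 u \<and> Lp_on \<Omega> 2 Du \<and>
     (\<forall>\<psi> i. test_function \<Omega> \<psi> \<longrightarrow>
        (LINT x|lebesgue_on \<Omega>. u x * (grad \<psi> x $ i)) = - (LINT x|lebesgue_on \<Omega>. (Du x $ i) * \<psi> x))"

text \<open>The closure of the test functions with respect to the norm of \<open>W\<^sup>1\<^sup>,\<^sup>2(\<Omega>)\<close>.\<close>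

definition W12_0 :: "(real^'n) set \<Rightarrow> (real^'n \<Rightarrow> real) \<Rightarrow> (real^'n \<Rightarrow> real^'n) \<Rightarrow> bool" where
  "W12_0 \<Omega> u Du \<longleftrightarrow> W12 \<Omega> u Du \<and>
     (\<exists>\<phi>. (\<forall>k. test_function \<Omega> (\<phi> k)) \<and>
        (\<lambda>k. LINT x|lebesgue_on \<Omega>. (\<phi> k x - u x)\<^sup>2 + (norm (grad (\<phi> k) x - Du x))\<^sup>2) \<longlonglongrightarrow> 0)"

section \<open>The operator\<close>

definition uniformly_elliptic :: "(real^'n) set \<Rightarrow> real \<Rightarrow> (real^'n \<Rightarrow> real^'n^'n) \<Rightarrow> bool" where
  "uniformly_elliptic \<Omega> l A \<longleftrightarrow> (\<forall>x\<in>\<Omega>. \<forall>\<xi>. l * (norm \<xi>)\<^sup>2 \<le> (A x *v \<xi>) \<bullet> \<xi>)"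

text \<open>\<open>d \<ge> div b\<close> in the sense of distributions.\<close>

definition ge_div :: "(real^'n) set \<Rightarrow> (real^'n \<Rightarrow> real) \<Rightarrow> (real^'n \<Rightarrow> real^'n) \<Rightarrow> bool" where
  "ge_div \<Omega> d b \<longleftrightarrow> (\<forall>\<phi>. test_function \<Omega> \<phi> \<longrightarrow> (\<forall>x. 0 \<le> \<phi> x) \<longrightarrow>
     0 \<le> (LINT x|lebesgue_on \<Omega>. d x * \<phi> x + b x \<bullet> grad \<phi> x))"

text \<open>\<open>u \<in> W\<^sub>0\<^sup>1\<^sup>,\<^sup>2(\<Omega>)\<close> is a weak solution of \<open>- div (A \<nabla>u + b u) + c \<cdot> \<nabla>u + d u = f\<close>.\<close>

definition weak_solution ::
  "(real^'n) set \<Rightarrow> (real^'n \<Rightarrow> real^'n^'n) \<Rightarrow> (real^'n \<Rightarrow> real^'n) \<Rightarrow> (real^'n \<Rightarrow> real^'n) \<Rightarrow>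
   (real^'n \<Rightarrow> real) \<Rightarrow> (real^'n \<Rightarrow> real) \<Rightarrow> (real^'n \<Rightarrow> real) \<Rightarrow> bool" where
  "weak_solution \<Omega> A b c d f u \<longleftrightarrow> (\<exists>Du. W12_0 \<Omega> u Du \<and>
     (\<forall>\<psi>. test_function \<Omega> \<psi> \<longrightarrow>
        (LINT x|lebesgue_on \<Omega>. (A x *v Du x) \<bullet> grad \<psi> x + (b x \<bullet> grad \<psi> x) * u x
            + (c x \<bullet> Du x) * \<psi> x + d x * u x * \<psi> x)
        = (LINT x|lebesgue_on \<Omega>. f x * \<psi> x)))"

section \<open>Green's functions\<close>

text \<open>\<open>green_function \<Omega> A b c d G\<close>: \<open>G\<close> is Green's function for \<open>L u = 0\<close> in \<open>\<Omega>\<close>, where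
  \<open>L u = - div (A \<nabla>u + b u) + c \<cdot> \<nabla>u + d u\<close>. The function \<open>u\<close> below is the solution
  \<open>S \<phi>\<close> (unique up to a null set for the coefficients considered) of the transposed equation
  \<open>L\<^sup>T u = \<phi>\<close>; the transpose of \<open>L\<close> has coefficients \<open>(A\<^sup>T, c, b, d)\<close>.

  The measurability of \<open>G\<close> on \<open>\<Omega> \<times> \<Omega>\<close> is part of the notion: the remaining clauses only involve
  the slices \<open>G(\<cdot>, y)\<close>, and without it they do not determine \<open>G\<close> up to a null set of
  \<open>\<Omega> \<times> \<Omega>\<close> (under the continuum hypothesis there is a subset of the square, not a null set,
  all of whose slices in one direction are countable).\<close>

definition green_function ::
  "(real^'n) set \<Rightarrow> (real^'n \<Rightarrow> real^'n^'n) \<Rightarrow> (real^'n \<Rightarrow> real^'n) \<Rightarrow> (real^'n \<Rightarrow> real^'n) \<Rightarrow>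
   (real^'n \<Rightarrow> real) \<Rightarrow> (real^'n \<Rightarrow> real^'n \<Rightarrow> real) \<Rightarrow> bool" where
  "green_function \<Omega> A b c d G \<longleftrightarrow>
     (\<lambda>(x, y). G x y) \<in> borel_measurable (lebesgue_on (\<Omega> \<times> \<Omega>)) \<and>
     (AE y in lebesgue_on \<Omega>. integrable (lebesgue_on \<Omega>) (\<lambda>x. G x y)) \<and>
     (\<forall>\<phi>. Linf_on \<Omega> \<phi> \<longrightarrow>
        (\<exists>u. weak_solution \<Omega> (\<lambda>x. transpose (A x)) c b d \<phi> u \<and>
             (AE y in lebesgue_on \<Omega>. u y = (LINT x|lebesgue_on \<Omega>. G x y * \<phi> x))))"

end

theory Submission
  imports Defs
begin

text \<open>The idea is duality. Let \<open>u\<close> be the solution of the transposed equation with data \<open>\<phi>\<close>, and \<open>v\<close> the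
  solution of the original equation with data \<open>f\<close>. Testing the equation of \<open>v\<close> with \<open>u\<close>, and that of \<open>u\<close>
  with \<open>v\<close>, produces the same bilinear form twice, so \<open>\<integral> f u = \<integral> \<phi> v\<close>
  (\<open>weak_solution_duality\<close>). Inserting the representations of \<open>u\<close> by \<open>G\<close> and of \<open>v\<close> by \<open>g\<close>,
  with indicators of Borel sets \<open>E\<close> and \<open>F\<close> as data, says that the integral of \<open>G x y\<close> over
  \<open>E \<times> F\<close>, first in \<open>x\<close> and then in \<open>y\<close>, equals that of \<open>g y x\<close> in the opposite order.

  Two points need work. First, the weak equations are given for test functions only, and \<open>u\<close>, \<open>v\<close>
  are merely limits of such functions. The form is continuous on the Sobolev space because its terms
  with \<open>b\<close>, \<open>c\<close>, \<open>d\<close> are controlled by \<open>\<integral> h u\<^sup>2 \<le> C \<integral> (norm (\<nabla>u))\<^sup>2\<close> for the weight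
  \<open>h = 1 + (norm b)\<^sup>2 + (norm c)\<^sup>2 + \<bar>d\<bar>\<close>, which has an integrable power \<open>n / 2\<close>
  (\<open>weighted_sobolev_C1\<close>, \<open>weighted_L2_tendsto\<close>). This is the Sobolev inequality with the
  critical exponent \<open>2 n / (n - 2)\<close> (\<open>sobolev_C1\<close>), which is derived from its version for
  integrable gradients (\<open>gagliardo\<close>) and thus from the Loomis--Whitney inequality
  (\<open>foldr_line_int_prod_le\<close>).

  Secondly, the kernels are known to be integrable only slice by slice, so Fubini's theorem does not
  apply to them directly. It applies on the sets where the slices of both kernels have norm at most
  \<open>k\<close>; there the integrals over all rectangles agree, hence the kernels agree almost
  everywhere, and \<open>k\<close> tends to infinity (\<open>kernel_AE_eq\<close>).\<close>

section \<open>The Hoelder inequality for several factors\<close>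

text \<open>The inequality needs no powers of integrals other than \<open>1 / m\<close>. With roots that accept the value \<open>\<infinity>\<close> no integral
  has to be known to be finite in advance.\<close>

definition eroot :: "nat \<Rightarrow> ennreal \<Rightarrow> ennreal" where
  "eroot m a = (if a = top then top else ennreal (root m (enn2real a)))"

lemma eroot_power:
  assumes "0 < m" shows "eroot m a ^ m = a"
  using assms by (cases a) (auto simp: eroot_def ennreal_power top_power_ennreal)

lemma ennreal_power_mono_iff:
  fixes a b :: ennreal assumes "0 < m" shows "a ^ m \<le> b ^ m \<longleftrightarrow> a \<le> b"
  using assms by (cases a; cases b)
    (auto simp: ennreal_power top_power_ennreal ennreal_le_iff top_unique power_mono_iff)

lemma ennreal_power_eq_iff:
  fixes a b :: ennreal assumes "0 < m" shows "a ^ m = b ^ m \<longleftrightarrow> a = b"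
  using ennreal_power_mono_iff[OF assms] by (metis order.eq_iff)

lemma eroot_of_power: "0 < m \<Longrightarrow> eroot m (a ^ m) = a"
  using eroot_power ennreal_power_eq_iff by blast

lemma eroot_mono: "0 < m \<Longrightarrow> a \<le> b \<Longrightarrow> eroot m a \<le> eroot m b"
  using eroot_power ennreal_power_mono_iff by metis

lemma eroot_mult: "0 < m \<Longrightarrow> eroot m (a * b) = eroot m a * eroot m b"
  using eroot_power ennreal_power_eq_iff by (metis power_mult_distrib)

lemma eroot_prod:
  assumes "0 < m" shows "eroot m (\<Prod>i\<in>S. f i) = (\<Prod>i\<in>S. eroot m (f i))"
proof -
  have "eroot m (\<Prod>i\<in>S. f i) ^ m = (\<Prod>i\<in>S. eroot m (f i)) ^ m"
    by (simp only: prod_power_distrib eroot_power[OF assms])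
  then show ?thesis using ennreal_power_eq_iff[OF assms] by blast
qed

lemma borel_measurable_eroot [measurable]: "eroot m \<in> borel_measurable borel"
  unfolding eroot_def by measurable

lemma ennreal_am_gm:
  fixes f :: "'i \<Rightarrow> ennreal"
  assumes "finite S" "S \<noteq> {}"
  shows "(\<Prod>i\<in>S. eroot (card S) (f i)) \<le> (\<Sum>i\<in>S. f i) / of_nat (card S)"
proof (cases "\<exists>i\<in>S. f i = top")
  case True
  then have "(\<Sum>i\<in>S. f i) = top" using assms by auto
  moreover have "card S > 0" using assms by (simp add: card_gt_0_iff)
  ultimately show ?thesis by (simp add: ennreal_top_divide)
next
  case False
  define x where "x i = enn2real (f i)" for i
  have fx: "f i = ennreal (x i)" "0 \<le> x i" if "i \<in> S" for i
    using that False by (auto simp: x_def less_top)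
  have c: "0 < card S" using assms by (simp add: card_gt_0_iff)
  have "root (card S) (\<Prod>i\<in>S. x i) \<le> (\<Sum>i\<in>S. x i) / real (card S)"
    using arith_geom_mean[OF assms, of x] fx c
    by (simp add: root_powr_inverse prod_nonneg sum_divide_distrib)
  moreover have "(\<Prod>i\<in>S. eroot (card S) (f i)) = eroot (card S) (ennreal (\<Prod>i\<in>S. x i))"
    using fx by (simp add: eroot_prod[OF c, symmetric] prod_ennreal)
  moreover have "\<dots> = ennreal (root (card S) (\<Prod>i\<in>S. x i))"
    using fx by (simp add: eroot_def prod_nonneg)
  moreover have "(\<Sum>i\<in>S. f i) / of_nat (card S) = ennreal ((\<Sum>i\<in>S. x i) / real (card S))"
    using fx c by (simp add: sum_nonneg divide_ennreal[symmetric] ennreal_of_nat_eq_real_of_nat)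
  ultimately show ?thesis by (simp add: ennreal_leI)
qed

text \<open>The Hoelder inequality for any number of factors with equal exponents: after dividing every \<open>h i\<close> by
  its integral \<open>a i\<close>, it is the integrated inequality between the geometric and the arithmetic mean.\<close>

lemma nn_integral_prod_eroot_le:
  fixes h :: "'i \<Rightarrow> 'a \<Rightarrow> ennreal"
  assumes S: "finite S" "S \<noteq> {}"
    and [measurable]: "\<And>i. i \<in> S \<Longrightarrow> h i \<in> borel_measurable M"
  shows "(\<integral>\<^sup>+x. (\<Prod>i\<in>S. eroot (card S) (h i x)) \<partial>M) \<le> (\<Prod>i\<in>S. eroot (card S) (\<integral>\<^sup>+x. h i x \<partial>M))"
proof -
  define m where "m = card S"
  have m: "0 < m" using S by (simp add: m_def card_gt_0_iff)
  define a where "a i = (\<integral>\<^sup>+x. h i x \<partial>M)" for i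
  have z: "eroot m c = 0 \<longleftrightarrow> c = 0" "eroot m c = top \<longleftrightarrow> c = top" for c
    using eroot_power[OF m, of c] m by (auto simp: eroot_def)
  consider (zero) i where "i \<in> S" "a i = 0" | (top) i where "i \<in> S" "a i = top" "\<And>j. j \<in> S \<Longrightarrow> a j \<noteq> 0"
    | (fin) "\<And>j. j \<in> S \<Longrightarrow> a j \<noteq> 0 \<and> a j \<noteq> top" by blast
  then show ?thesis
  proof cases
    case zero
    have "AE x in M. h i x = 0" using zero by (simp add: a_def nn_integral_0_iff_AE)
    then have "AE x in M. (\<Prod>i\<in>S. eroot (card S) (h i x)) = 0"
      by eventually_elim (use zero S z m_def in auto)
    then have "(\<integral>\<^sup>+x. (\<Prod>i\<in>S. eroot (card S) (h i x)) \<partial>M) = 0"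
      by (subst nn_integral_0_iff_AE) auto
    then show ?thesis by simp
  next
    case top
    have "(\<Prod>i\<in>S. eroot m (a i)) = top"
      unfolding ennreal_prod_eq_top using top z S by auto
    then show ?thesis by (simp add: a_def m_def)
  next
    case fin
    have eq: "h i x = a i * (h i x / a i)" if "i \<in> S" for i x
      using fin[OF that] by (simp add: ennreal_times_divide ennreal_mult_divide_eq mult.commute[of "a i"])
    have "(\<integral>\<^sup>+x. (\<Prod>i\<in>S. eroot m (h i x)) \<partial>M)
        = (\<integral>\<^sup>+x. (\<Prod>i\<in>S. eroot m (a i)) * (\<Prod>i\<in>S. eroot m (h i x / a i)) \<partial>M)"
      by (intro nn_integral_cong)
        (simp add: prod.distrib[symmetric] eroot_mult[OF m, symmetric] eq[symmetric] cong: prod.cong)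
    also have "\<dots> = (\<Prod>i\<in>S. eroot m (a i)) * (\<integral>\<^sup>+x. (\<Prod>i\<in>S. eroot m (h i x / a i)) \<partial>M)"
      by (intro nn_integral_cmult) measurable
    also have "(\<integral>\<^sup>+x. (\<Prod>i\<in>S. eroot m (h i x / a i)) \<partial>M)
        \<le> (\<integral>\<^sup>+x. (\<Sum>i\<in>S. h i x / a i) / of_nat m \<partial>M)"
      unfolding m_def by (intro nn_integral_mono ennreal_am_gm S)
    also have "\<dots> = (\<Sum>i\<in>S. a i / a i) / of_nat m"
      by (simp add: nn_integral_divide nn_integral_sum a_def)
    also have "\<dots> = 1"
    proof -
      have "(\<Sum>i\<in>S. a i / a i) = of_nat m" using fin by (simp add: less_top m_def)
      moreover have "of_nat m / of_nat m = (1::ennreal)"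
        by (rule ennreal_divide_self) (use m in \<open>auto simp: of_nat_less_top\<close>)
      ultimately show ?thesis by simp
    qed
    finally show ?thesis by (simp add: a_def m_def mult_left_mono)
  qed
qed

lemma nn_integral_prod_power_le:
  fixes h :: "'i \<Rightarrow> 'a \<Rightarrow> ennreal"
  assumes S: "finite S" "S \<noteq> {}"
    and [measurable]: "\<And>i. i \<in> S \<Longrightarrow> h i \<in> borel_measurable M"
  shows "(\<integral>\<^sup>+x. (\<Prod>i\<in>S. h i x) \<partial>M) ^ card S \<le> (\<Prod>i\<in>S. \<integral>\<^sup>+x. h i x ^ card S \<partial>M)"
proof -
  have m: "0 < card S" using S by (simp add: card_gt_0_iff)
  have "(\<integral>\<^sup>+x. (\<Prod>i\<in>S. h i x) \<partial>M) \<le> (\<Prod>i\<in>S. eroot (card S) (\<integral>\<^sup>+x. h i x ^ card S \<partial>M))"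
    using nn_integral_prod_eroot_le[OF S, of "\<lambda>i x. h i x ^ card S" M] by (simp add: eroot_of_power[OF m])
  then have "(\<integral>\<^sup>+x. (\<Prod>i\<in>S. h i x) \<partial>M) ^ card S
      \<le> (\<Prod>i\<in>S. eroot (card S) (\<integral>\<^sup>+x. h i x ^ card S \<partial>M)) ^ card S"
    by (intro power_mono) auto
  also have "\<dots> = (\<Prod>i\<in>S. \<integral>\<^sup>+x. h i x ^ card S \<partial>M)"
    by (simp add: prod_power_distrib eroot_power[OF m])
  finally show ?thesis .
qed

section \<open>Integration along coordinate lines and the Gagliardo inequality\<close>

definition coord_update :: "'a::euclidean_space \<Rightarrow> real \<Rightarrow> 'a \<Rightarrow> 'a" where
  "coord_update j t x = x + (t - x \<bullet> j) *\<^sub>R j"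

definition line_int :: "'a::euclidean_space \<Rightarrow> ('a \<Rightarrow> ennreal) \<Rightarrow> 'a \<Rightarrow> ennreal" where
  "line_int j f x = (\<integral>\<^sup>+t. f (coord_update j t x) \<partial>lborel)"

lemma inner_coord_update: "j \<in> Basis \<Longrightarrow> b \<in> Basis \<Longrightarrow> coord_update j t x \<bullet> b = (if b = j then t else x \<bullet> b)"
  by (auto simp: coord_update_def inner_add_left inner_Basis)

lemma coord_update_coord_update_same: "j \<in> Basis \<Longrightarrow> coord_update j s (coord_update j t x) = coord_update j s x"
  by (rule euclidean_eqI) (simp add: inner_coord_update)

lemma coord_update_commute: "j \<in> Basis \<Longrightarrow> k \<in> Basis \<Longrightarrow> j \<noteq> k \<Longrightarrow> coord_update j s (coord_update k t x) = coord_update k t (coord_update j s x)"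
  by (rule euclidean_eqI) (simp add: inner_coord_update)

lemma coord_update_self: "j \<in> Basis \<Longrightarrow> coord_update j (x \<bullet> j) x = x"
  by (simp add: coord_update_def)

lemma measurable_coord_update [measurable]: "(\<lambda>(x, t). coord_update j t x) \<in> borel_measurable (borel \<Otimes>\<^sub>M lborel)"
  unfolding coord_update_def by measurable

lemma borel_measurable_line_int [measurable]:
  assumes [measurable]: "f \<in> borel_measurable borel"
  shows "line_int j f \<in> borel_measurable borel"
  unfolding line_int_def by measurable

lemma line_int_mono: "(\<And>x. f x \<le> g x) \<Longrightarrow> line_int j f x \<le> line_int j g x"
  unfolding line_int_def by (intro nn_integral_mono)

definition const_along :: "'a::euclidean_space \<Rightarrow> ('a \<Rightarrow> ennreal) \<Rightarrow> bool" where
  "const_along j f \<longleftrightarrow> (\<forall>x t. f (coord_update j t x) = f x)"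

lemma const_along_line_int: "j \<in> Basis \<Longrightarrow> const_along j (line_int j f)"
  by (simp add: const_along_def line_int_def coord_update_coord_update_same)

lemma const_along_foldr:
  "const_along j f \<Longrightarrow> j \<in> Basis \<Longrightarrow> set ks \<subseteq> Basis - {j} \<Longrightarrow> const_along j (foldr line_int ks f)"
proof (induction ks)
  case (Cons k ks)
  then have "coord_update k s (coord_update j t x) = coord_update j t (coord_update k s x)" for s t x
    by (intro coord_update_commute) auto
  with Cons show ?case by (auto simp: const_along_def line_int_def)
qed simp

lemma borel_measurable_foldr_line_int [measurable]:
  "f \<in> borel_measurable borel \<Longrightarrow> foldr line_int js f \<in> borel_measurable borel"
  by (induction js) auto

text \<open>Integrating out the coordinates in a list one after the other is integration over the product of
  these coordinates, by Tonelli; the remaining coordinates of \<open>x\<close> are kept.\<close>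

lemma foldr_line_int_eq:
  fixes f :: "'a::euclidean_space \<Rightarrow> ennreal"
  assumes f[measurable]: "f \<in> borel_measurable borel" and "distinct js" "set js \<subseteq> Basis"
  shows "foldr line_int js f x =
    (\<integral>\<^sup>+z. f (\<Sum>b\<in>Basis. (if b \<in> set js then z b else x \<bullet> b) *\<^sub>R b) \<partial>(\<Pi>\<^sub>M b\<in>set js. lborel))"
  using assms(2,3)
proof (induction js arbitrary: x)
  case Nil
  then show ?case by (simp add: PiM_empty nn_integral_count_space_finite euclidean_representation)
next
  case (Cons j js)
  interpret product_sigma_finite "\<lambda>_::'a. lborel :: real measure" ..
  have [simp]: "j \<notin> set js" "j \<in> Basis" using Cons.prems by auto
  have m: "(\<lambda>z. f (\<Sum>b\<in>Basis. (if b \<in> insert j (set js) then z b else x \<bullet> b) *\<^sub>R b))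
      \<in> borel_measurable (\<Pi>\<^sub>M b\<in>insert j (set js). lborel)"
  proof (intro measurable_compose[OF _ f] borel_measurable_sum borel_measurable_scaleR)
    fix b :: 'a
    show "(\<lambda>z. if b \<in> insert j (set js) then z b else x \<bullet> b)
        \<in> borel_measurable (\<Pi>\<^sub>M b\<in>insert j (set js). lborel)"
      by (cases "b \<in> insert j (set js)")
        (auto simp del: insert_iff intro!: measurable_component_singleton[THEN measurable_compose])
  qed auto
  have "foldr line_int (j # js) f x = (\<integral>\<^sup>+t. foldr line_int js f (coord_update j t x) \<partial>lborel)"
    by (simp add: line_int_def)
  also have "\<dots> = (\<integral>\<^sup>+t. (\<integral>\<^sup>+z. f (\<Sum>b\<in>Basis. (if b \<in> set js then z b else coord_update j t x \<bullet> b) *\<^sub>R b)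
      \<partial>(\<Pi>\<^sub>M b\<in>set js. lborel)) \<partial>lborel)"
    using Cons by simp
  also have "\<dots> = (\<integral>\<^sup>+t. (\<integral>\<^sup>+z. f (\<Sum>b\<in>Basis. (if b \<in> insert j (set js) then (z(j := t)) b else x \<bullet> b) *\<^sub>R b)
      \<partial>(\<Pi>\<^sub>M b\<in>set js. lborel)) \<partial>lborel)"
    by (intro nn_integral_cong arg_cong[where f = f] sum.cong refl) (auto simp: inner_coord_update)
  also have "\<dots> = (\<integral>\<^sup>+z. f (\<Sum>b\<in>Basis. (if b \<in> insert j (set js) then z b else x \<bullet> b) *\<^sub>R b)
      \<partial>(\<Pi>\<^sub>M b\<in>insert j (set js). lborel))"
    by (subst product_nn_integral_insert_rev[OF _ _ m]) auto
  finally show ?case by simp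
qed

lemma foldr_line_int_Basis:
  fixes f :: "'a::euclidean_space \<Rightarrow> ennreal"
  assumes f[measurable]: "f \<in> borel_measurable borel" and "distinct js" "set js = Basis"
  shows "foldr line_int js f x = (\<integral>\<^sup>+y. f y \<partial>lborel)"
proof -
  have "(\<integral>\<^sup>+y. f y \<partial>lborel) = (\<integral>\<^sup>+z. f (\<Sum>b\<in>Basis. z b *\<^sub>R b) \<partial>(\<Pi>\<^sub>M b\<in>Basis. lborel))"
    by (subst lborel_eq, subst nn_integral_distr) auto
  also have "\<dots> = foldr line_int js f x"
    using assms by (simp add: foldr_line_int_eq cong: sum.cong)
  finally show ?thesis by simp
qed

text \<open>One application of \<open>line_int j\<close> turns the factor \<open>H j\<close>, which does not depend on
  coordinate \<open>j\<close>, into a constant; the \<open>n - 1\<close> other factors carry the exponent \<open>1 / (n - 1)\<close>,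
  so the Hoelder inequality applies to them exactly. The exponent never changes during the
  induction, which is why the list of coordinates and not the dimension is the induction variable:
  after all steps each \<open>H i\<close> has been integrated in every coordinate other than \<open>i\<close>. This is the
  Loomis--Whitney inequality.\<close>

lemma foldr_line_int_prod_le:
  fixes H :: "'a::euclidean_space \<Rightarrow> 'a \<Rightarrow> ennreal"
  assumes dim: "2 \<le> DIM('a)"
    and H[measurable]: "\<And>i. i \<in> Basis \<Longrightarrow> H i \<in> borel_measurable borel"
    and c: "\<And>i. i \<in> Basis \<Longrightarrow> const_along i (H i)"
    and "set js \<subseteq> Basis"
  shows "foldr line_int js (\<lambda>x. \<Prod>i\<in>Basis. eroot (DIM('a) - 1) (H i x)) x
    \<le> (\<Prod>i\<in>Basis. eroot (DIM('a) - 1) (foldr line_int (filter (\<lambda>j. j \<noteq> i) js) (H i) x))"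
  using assms(4)
proof (induction js arbitrary: x)
  case (Cons j js)
  define m where "m = DIM('a) - 1"
  define K where "K i = foldr line_int (filter (\<lambda>j. j \<noteq> i) js) (H i)" for i
  have [measurable]: "K i \<in> borel_measurable borel" if "i \<in> Basis" for i
    using that unfolding K_def by measurable
  have j: "j \<in> Basis" using Cons.prems by simp
  have card: "card (Basis - {j}) = m" using j by (simp add: m_def card_Diff_singleton)
  have ne: "Basis - {j} \<noteq> {}" using card dim m_def by force
  have "const_along j (K j)"
    unfolding K_def using Cons.prems by (intro const_along_foldr c j) auto
  then have Kj: "K j (coord_update j t x) = K j x" for t by (simp add: const_along_def)
  have "foldr line_int (j # js) (\<lambda>x. \<Prod>i\<in>Basis. eroot m (H i x)) x
      \<le> line_int j (\<lambda>x. \<Prod>i\<in>Basis. eroot m (K i x)) x"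
    unfolding K_def m_def using Cons by (auto intro: line_int_mono)
  also have "\<dots> = (\<integral>\<^sup>+t. eroot m (K j x) * (\<Prod>i\<in>Basis - {j}. eroot m (K i (coord_update j t x))) \<partial>lborel)"
    unfolding line_int_def by (intro nn_integral_cong) (simp add: prod.remove[OF _ j] Kj)
  also have "\<dots> = eroot m (K j x) * (\<integral>\<^sup>+t. (\<Prod>i\<in>Basis - {j}. eroot m (K i (coord_update j t x))) \<partial>lborel)"
    by (intro nn_integral_cmult) measurable
  also have "\<dots> \<le> eroot m (K j x) * (\<Prod>i\<in>Basis - {j}. eroot m (\<integral>\<^sup>+t. K i (coord_update j t x) \<partial>lborel))"
    unfolding card[symmetric] by (intro mult_left_mono nn_integral_prod_eroot_le ne) auto
  also have "\<dots> = (\<Prod>i\<in>Basis. eroot m (foldr line_int (filter (\<lambda>k. k \<noteq> i) (j # js)) (H i) x))"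
  proof -
    have "(\<Prod>i\<in>Basis - {j}. eroot m (\<integral>\<^sup>+t. K i (coord_update j t x) \<partial>lborel))
        = (\<Prod>i\<in>Basis - {j}. eroot m (foldr line_int (filter (\<lambda>k. k \<noteq> i) (j # js)) (H i) x))"
      by (intro prod.cong) (auto simp: K_def line_int_def)
    then show ?thesis by (simp add: prod.remove[OF finite_Basis j] K_def)
  qed
  finally show ?case by (simp add: m_def)
qed simp

text \<open>The endpoint \<open>p = 1\<close> of the Sobolev inequality, which bounds the integral of
  \<open>u powr (n / (n - 1))\<close> by that of \<open>norm (\<nabla>u)\<close>. The only property of the gradient that enters is the
  fundamental theorem of calculus along coordinate lines, here the hypothesis on \<open>u\<close> and \<open>w\<close>:
  multiplying it over the \<open>n\<close> directions gives a product as in the previous lemma.\<close>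

lemma gagliardo:
  fixes u w :: "'a::euclidean_space \<Rightarrow> ennreal"
  assumes dim: "2 \<le> DIM('a)"
    and [measurable]: "u \<in> borel_measurable borel" "w \<in> borel_measurable borel"
    and le: "\<And>i x. i \<in> Basis \<Longrightarrow> u x \<le> line_int i w x"
  shows "(\<integral>\<^sup>+x. eroot (DIM('a) - 1) (u x ^ DIM('a)) \<partial>lborel) ^ (DIM('a) - 1) \<le> (\<integral>\<^sup>+x. w x \<partial>lborel) ^ DIM('a)"
proof -
  define n where "n = DIM('a)"
  define m where "m = DIM('a) - 1"
  have m: "0 < m" using dim by (simp add: m_def)
  define W where "W = (\<integral>\<^sup>+x. w x \<partial>lborel)"
  obtain js :: "'a list" where js: "set js = Basis" "distinct js"
    using finite_distinct_list[OF finite_Basis] by blast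
  have "(\<integral>\<^sup>+x. eroot m (u x ^ n) \<partial>lborel) \<le> (\<integral>\<^sup>+x. (\<Prod>i\<in>Basis. eroot m (line_int i w x)) \<partial>lborel)"
  proof (intro nn_integral_mono)
    fix x
    have "u x ^ n = (\<Prod>i\<in>(Basis::'a set). u x)" by (simp add: n_def)
    also have "\<dots> \<le> (\<Prod>i\<in>Basis. line_int i w x)" by (intro prod_mono_ennreal) (use le in auto)
    finally show "eroot m (u x ^ n) \<le> (\<Prod>i\<in>Basis. eroot m (line_int i w x))"
      using eroot_mono[OF m] by (simp add: eroot_prod[OF m, symmetric])
  qed
  also have "\<dots> = foldr line_int js (\<lambda>x. \<Prod>i\<in>Basis. eroot m (line_int i w x)) 0"
    using js by (intro foldr_line_int_Basis[symmetric]) auto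
  also have "\<dots> \<le> (\<Prod>i\<in>Basis. eroot m (foldr line_int (filter (\<lambda>j. j \<noteq> i) js) (line_int i w) 0))"
    unfolding m_def using js by (intro foldr_line_int_prod_le dim) (auto intro: const_along_line_int)
  also have "\<dots> = (\<Prod>i\<in>(Basis::'a set). eroot m W)"
  proof (intro prod.cong refl arg_cong[where f = "eroot m"])
    fix i :: 'a assume "i \<in> Basis"
    then have "foldr line_int (filter (\<lambda>j. j \<noteq> i) js @ [i]) w 0 = W"
      unfolding W_def using js by (intro foldr_line_int_Basis) auto
    then show "foldr line_int (filter (\<lambda>j. j \<noteq> i) js) (line_int i w) 0 = W" by simp
  qed
  also have "\<dots> = eroot m W ^ n" by (simp add: n_def)
  finally have "(\<integral>\<^sup>+x. eroot m (u x ^ n) \<partial>lborel) ^ m \<le> (eroot m W ^ n) ^ m"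
    by (intro power_mono) auto
  also have "\<dots> = W ^ n"
    by (metis eroot_power[OF m] power_mult mult.commute)
  finally show ?thesis by (simp add: n_def m_def W_def)
qed

section \<open>The Sobolev inequality\<close>

lemma abs_le_nn_integral_deriv:
  fixes h :: "real \<Rightarrow> real"
  assumes "\<And>t. (h has_real_derivative h' t) (at t)" "continuous_on UNIV h'" "a \<le> t" "h a = 0"
  shows "ennreal \<bar>h t\<bar> \<le> (\<integral>\<^sup>+s. ennreal \<bar>h' s\<bar> \<partial>lborel)"
proof -
  have [measurable]: "h' \<in> borel_measurable borel"
    using assms(2) by (rule borel_measurable_continuous_onI)
  have "h t = (LINT s|lborel. h' s * indicator {a..t} s)"
    using integral_FTC_Icc_real[of a t h h'] assms continuous_on_eq_continuous_at[of UNIV h'] by auto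
  then have "ennreal \<bar>h t\<bar> \<le> (\<integral>\<^sup>+s. ennreal (norm (h' s * indicator {a..t} s)) \<partial>lborel)"
    using integral_norm_bound_ennreal[of lborel "\<lambda>s. h' s * indicator {a..t} s"]
      borel_integrable_atLeastAtMost[of a t h'] assms(2) continuous_on_eq_continuous_at[of UNIV h']
    by (auto simp: real_norm_def simp del: norm_mult)
  also have "\<dots> \<le> (\<integral>\<^sup>+s. ennreal \<bar>h' s\<bar> \<partial>lborel)"
    by (intro nn_integral_mono) (auto simp: indicator_def)
  finally show ?thesis .
qed

text \<open>The exponent is written as \<open>\<alpha> + 2\<close> with \<open>\<alpha> > 0\<close> so that the derivative
  \<open>(\<alpha> + 2) * y * \<bar>y\<bar> powr \<alpha>\<close> is visibly continuous, with no sign function.\<close>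

lemma has_real_derivative_abs_powr:
  fixes y \<alpha> :: real
  assumes "0 < \<alpha>"
  shows "((\<lambda>y. \<bar>y\<bar> powr (\<alpha> + 2)) has_real_derivative (\<alpha> + 2) * (y * \<bar>y\<bar> powr \<alpha>)) (at y)"
proof (cases y "0::real" rule: linorder_cases)
  case equal
  have "isCont (\<lambda>y::real. y * \<bar>y\<bar> powr \<alpha>) 0"
    using assms by (intro continuous_intros) auto
  moreover have "\<forall>z. \<bar>z\<bar> powr (\<alpha> + 2) - \<bar>0\<bar> powr (\<alpha> + 2) = (z * \<bar>z\<bar> powr \<alpha>) * (z - 0)"
    by (auto simp: powr_add power2_eq_square)
  ultimately show ?thesis
    unfolding equal CARAT_DERIV by (intro exI[of _ "\<lambda>y. y * \<bar>y\<bar> powr \<alpha>"]) auto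
next
  case greater
  have "((\<lambda>y. y powr (\<alpha> + 2)) has_real_derivative (\<alpha> + 2) * (y * \<bar>y\<bar> powr \<alpha>)) (at y)"
    using greater by (auto intro!: derivative_eq_intros simp: powr_add power2_eq_square powr_diff field_simps)
  then show ?thesis
    by (rule has_field_derivative_transform_within_open[of _ _ _ "{0<..}"]) (use greater in auto)
next
  case less
  have "((\<lambda>y. (- y) powr (\<alpha> + 2)) has_real_derivative (\<alpha> + 2) * (y * \<bar>y\<bar> powr \<alpha>)) (at y)"
    using less by (auto intro!: derivative_eq_intros simp: powr_add power2_eq_square powr_diff field_simps)
  then show ?thesis
    by (rule has_field_derivative_transform_within_open[of _ _ _ "{..<0}"]) (use less in auto)
qed

lemma bounded_support_imp_bounded:
  fixes f :: "'a::euclidean_space \<Rightarrow> 'b::real_normed_vector"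
  assumes "continuous_on UNIV f" "\<And>x. R < norm x \<Longrightarrow> f x = 0"
  obtains B where "\<And>x. norm (f x) \<le> B"
proof -
  have "bounded (f ` cball 0 R)"
    by (intro compact_imp_bounded compact_continuous_image continuous_on_subset[OF assms(1)]) auto
  then obtain B where "\<And>x. norm x \<le> R \<Longrightarrow> norm (f x) \<le> B" unfolding bounded_iff by (metis image_eqI mem_cball_0)
  then have "norm (f x) \<le> max B 0" for x
    using assms(2)[of x] by (cases "norm x \<le> R") (auto simp: le_max_iff_disj)
  then show ?thesis using that by blast
qed

text \<open>The Gagliardo inequality is applied to \<open>\<bar>f\<bar> powr (\<alpha> + 2)\<close>, whose gradient is at most
  \<open>(\<alpha> + 2) * \<bar>f\<bar> powr (\<alpha> + 1) * norm D\<close>. The exponent \<open>\<alpha> = 2 / (n - 2)\<close> is the one for which,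
  after the Cauchy--Schwarz inequality, the same integral \<open>I\<close> of \<open>\<bar>f\<bar> powr (2 n / (n - 2))\<close>
  appears on both sides; it is finite, so its lower power can be cancelled. All roots
  are cleared by stating the result with natural powers.\<close>

lemma sobolev_C1:
  fixes f :: "'a::euclidean_space \<Rightarrow> real" and D :: "'a \<Rightarrow> 'a"
  assumes dim: "3 \<le> DIM('a)"
    and der: "\<And>x. (f has_derivative (\<lambda>h. D x \<bullet> h)) (at x)"
    and D: "continuous_on UNIV D"
    and supp: "\<And>x. R < norm x \<Longrightarrow> f x = 0"
  shows "(\<integral>\<^sup>+x. ennreal (\<bar>f x\<bar> powr (2 * DIM('a) / (DIM('a) - 2))) \<partial>lborel) ^ (DIM('a) - 2)
    \<le> ennreal ((2 * (DIM('a) - 1) / (DIM('a) - 2)) ^ (2 * DIM('a))) * (\<integral>\<^sup>+x. ennreal ((norm (D x))\<^sup>2) \<partial>lborel) ^ DIM('a)"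
proof -
  define n where "n = DIM('a)"
  define N where "N = real n"
  define \<alpha> where "\<alpha> = 2 / (N - 2)"
  define q where "q = 2 * N / (N - 2)"
  have n: "3 \<le> n" "3 \<le> N" using dim by (auto simp: n_def N_def)
  then have \<alpha>: "0 < \<alpha>" "\<alpha> + 2 = 2 * (N - 1) / (N - 2)" "2 * (\<alpha> + 1) = q" "(\<alpha> + 2) * N = q * (N - 1)"
    by (auto simp: \<alpha>_def q_def field_simps)
  have cf: "continuous_on UNIV f"
    using der by (meson continuous_at_imp_continuous_on has_derivative_continuous)
  then have [measurable]: "f \<in> borel_measurable borel" by (rule borel_measurable_continuous_onI)
  have [measurable]: "D \<in> borel_measurable borel" using D by (rule borel_measurable_continuous_onI)
  define u where "u x = ennreal (\<bar>f x\<bar> powr (\<alpha> + 2))" for x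
  define w where "w x = ennreal ((\<alpha> + 2) * (\<bar>f x\<bar> powr (\<alpha> + 1) * norm (D x)))" for x
  have [measurable]: "u \<in> borel_measurable borel" "w \<in> borel_measurable borel"
    by (auto simp: u_def[abs_def] w_def[abs_def])
  define I where "I = (\<integral>\<^sup>+x. ennreal (\<bar>f x\<bar> powr q) \<partial>lborel)"
  define E where "E = (\<integral>\<^sup>+x. ennreal ((norm (D x))\<^sup>2) \<partial>lborel)"
  have line: "u x \<le> line_int i w x" if i: "i \<in> Basis" for i x
  proof -
    define s where "s t = f (coord_update i t x)" for t
    define s' where "s' t = D (coord_update i t x) \<bullet> i" for t
    have cu: "continuous_on UNIV (\<lambda>t. coord_update i t x)"
      unfolding coord_update_def by (intro continuous_intros)
    have ds: "(s has_real_derivative s' t) (at t)" for t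
    proof -
      have "((\<lambda>t. coord_update i t x) has_derivative (\<lambda>h. h *\<^sub>R i)) (at t)"
        unfolding coord_update_def by (auto intro!: derivative_eq_intros)
      from has_derivative_compose[OF this der]
      show ?thesis
        by (simp add: s_def[abs_def] s'_def has_field_derivative_def mult.commute[of _ "D _ \<bullet> i"] mult_commute_abs)
    qed
    have cs: "continuous_on UNIV s" "continuous_on UNIV s'"
      unfolding s_def s'_def using cu
      by (auto intro!: continuous_intros continuous_on_compose2[OF cf] continuous_on_compose2[OF D])
    \<comment> \<open>a parameter to the left of \<open>x \<bullet> i\<close> at which the line has already left the support\<close>
    define a where "a = - \<bar>R\<bar> - 1 - \<bar>x \<bullet> i\<bar>"
    have "\<bar>R\<bar> < \<bar>coord_update i a x \<bullet> i\<bar>" using i by (simp add: inner_coord_update a_def)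
    also have "\<dots> \<le> norm (coord_update i a x)" using i by (rule Basis_le_norm)
    finally have "s a = 0" unfolding s_def by (intro supp) auto
    have "ennreal \<bar>\<bar>s (x \<bullet> i)\<bar> powr (\<alpha> + 2)\<bar>
        \<le> (\<integral>\<^sup>+t. ennreal \<bar>(\<alpha> + 2) * (s t * \<bar>s t\<bar> powr \<alpha>) * s' t\<bar> \<partial>lborel)"
    proof (rule abs_le_nn_integral_deriv[where a = a and t = "x \<bullet> i"
          and h = "\<lambda>t. \<bar>s t\<bar> powr (\<alpha> + 2)" and h' = "\<lambda>t. (\<alpha> + 2) * (s t * \<bar>s t\<bar> powr \<alpha>) * s' t"])
      show "((\<lambda>t. \<bar>s t\<bar> powr (\<alpha> + 2)) has_real_derivative (\<alpha> + 2) * (s t * \<bar>s t\<bar> powr \<alpha>) * s' t) (at t)" for t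
        by (rule DERIV_chain2[OF has_real_derivative_abs_powr[OF \<alpha>(1)] ds])
      show "continuous_on UNIV (\<lambda>t. (\<alpha> + 2) * (s t * \<bar>s t\<bar> powr \<alpha>) * s' t)"
        using \<alpha>(1) cs by (intro continuous_intros continuous_on_powr') auto
    qed (use \<open>s a = 0\<close> in \<open>auto simp: a_def\<close>)
    also have "\<dots> \<le> (\<integral>\<^sup>+t. w (coord_update i t x) \<partial>lborel)"
    proof (intro nn_integral_mono)
      fix t
      have "\<bar>(\<alpha> + 2) * (s t * \<bar>s t\<bar> powr \<alpha>) * s' t\<bar> = (\<alpha> + 2) * (\<bar>s t\<bar> powr (\<alpha> + 1) * \<bar>s' t\<bar>)"
        using \<alpha>(1) by (simp add: abs_mult powr_add)
      also have "\<dots> \<le> (\<alpha> + 2) * (\<bar>s t\<bar> powr (\<alpha> + 1) * norm (D (coord_update i t x)))"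
        using \<alpha>(1) Basis_le_norm[OF i] by (auto simp: s'_def intro!: mult_left_mono)
      finally show "ennreal \<bar>(\<alpha> + 2) * (s t * \<bar>s t\<bar> powr \<alpha>) * s' t\<bar> \<le> w (coord_update i t x)"
        unfolding w_def s_def by (rule ennreal_leI)
    qed
    finally show ?thesis by (simp add: u_def line_int_def s_def coord_update_self[OF i])
  qed
  have "eroot (n - 1) (u x ^ n) = ennreal (\<bar>f x\<bar> powr q)" for x
  proof -
    have "(\<bar>f x\<bar> powr (\<alpha> + 2)) ^ n = (\<bar>f x\<bar> powr q) ^ (n - 1)"
    proof (cases "f x = 0")
      case False
      then show ?thesis using \<alpha>(4) n by (simp add: powr_realpow[symmetric] powr_powr N_def of_nat_diff)
    qed (use n in \<open>auto simp: power_0_left\<close>)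
    then have "u x ^ n = ennreal (\<bar>f x\<bar> powr q) ^ (n - 1)" by (simp add: u_def ennreal_power)
    then show ?thesis using n by (simp add: eroot_of_power)
  qed
  then have "I ^ (n - 1) \<le> (\<integral>\<^sup>+x. w x \<partial>lborel) ^ n"
    using gagliardo[OF _ _ _ line] dim by (simp add: I_def n_def)
  also have "(\<integral>\<^sup>+x. w x \<partial>lborel) = ennreal (\<alpha> + 2) * (\<integral>\<^sup>+x. ennreal (\<bar>f x\<bar> powr (\<alpha> + 1)) * ennreal (norm (D x)) \<partial>lborel)"
    unfolding w_def using \<alpha>(1) by (subst nn_integral_cmult[symmetric]) (auto simp: ennreal_mult)
  finally have "(I ^ (n - 1))\<^sup>2 \<le> ((ennreal (\<alpha> + 2) * (\<integral>\<^sup>+x. ennreal (\<bar>f x\<bar> powr (\<alpha> + 1)) * ennreal (norm (D x)) \<partial>lborel)) ^ n)\<^sup>2"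
    by (intro power_mono) auto
  also have "\<dots> = ennreal (\<alpha> + 2) ^ (2 * n) * ((\<integral>\<^sup>+x. ennreal (\<bar>f x\<bar> powr (\<alpha> + 1)) * ennreal (norm (D x)) \<partial>lborel)\<^sup>2) ^ n"
    by (simp add: power_mult_distrib power_mult[symmetric] mult.commute)
  also have "\<dots> \<le> ennreal (\<alpha> + 2) ^ (2 * n) * (I * E) ^ n"
  proof (intro mult_left_mono power_mono)
    have "(\<integral>\<^sup>+x. ennreal (\<bar>f x\<bar> powr (\<alpha> + 1)) * ennreal (norm (D x)) \<partial>lborel)\<^sup>2
      \<le> (\<integral>\<^sup>+x. (ennreal (\<bar>f x\<bar> powr (\<alpha> + 1)))\<^sup>2 \<partial>lborel) * (\<integral>\<^sup>+x. (ennreal (norm (D x)))\<^sup>2 \<partial>lborel)"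
      by (rule Cauchy_Schwarz_nn_integral) auto
    also have "\<dots> = I * E"
      unfolding I_def E_def \<alpha>(3)[symmetric]
      by (simp add: ennreal_power powr_powr[symmetric] powr_numeral powr_mult_base power2_eq_square powr_add[symmetric] flip: ennreal_mult)
    finally show "(\<integral>\<^sup>+x. ennreal (\<bar>f x\<bar> powr (\<alpha> + 1)) * ennreal (norm (D x)) \<partial>lborel)\<^sup>2 \<le> I * E" .
  qed auto
  finally have "(I ^ (n - 1))\<^sup>2 \<le> ennreal (\<alpha> + 2) ^ (2 * n) * (I * E) ^ n" .
  moreover have "(I ^ (n - 1))\<^sup>2 = I ^ n * I ^ (n - 2)"
    using n by (auto simp: power_mult[symmetric] power_add[symmetric] intro!: arg_cong[where f = "\<lambda>k. I ^ k"])
  moreover have "ennreal (\<alpha> + 2) ^ (2 * n) = ennreal ((\<alpha> + 2) ^ (2 * n))"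
    using \<alpha>(1) by (intro ennreal_power) simp
  ultimately have main: "I ^ n * I ^ (n - 2) \<le> I ^ n * (ennreal ((\<alpha> + 2) ^ (2 * n)) * E ^ n)"
    by (simp add: power_mult_distrib mult_ac)
  have "I < top"
  proof -
    obtain B where B: "\<And>x. \<bar>f x\<bar> \<le> B"
      using bounded_support_imp_bounded[OF cf supp] by auto
    have "I \<le> (\<integral>\<^sup>+x. ennreal (\<bar>B\<bar> powr q) * indicator (cball (0::'a) R) x \<partial>lborel)"
      unfolding I_def
    proof (intro nn_integral_mono)
      fix x :: 'a
      show "ennreal (\<bar>f x\<bar> powr q) \<le> ennreal (\<bar>B\<bar> powr q) * indicator (cball 0 R) x"
      proof (cases "norm x \<le> R")
        case True
        have "\<bar>f x\<bar> powr q \<le> \<bar>B\<bar> powr q" using B[of x] n by (intro powr_mono2) (auto simp: q_def)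
        then show ?thesis using True by (simp add: ennreal_leI)
      qed (use supp n in \<open>auto simp: q_def\<close>)
    qed
    also have "\<dots> = ennreal (\<bar>B\<bar> powr q) * emeasure lborel (cball (0::'a) R)"
      by (rule nn_integral_cmult_indicator) simp
    also have "\<dots> < top"
      using emeasure_lborel_cball_finite[of "0::'a" R] by (simp add: ennreal_mult_less_top)
    finally show ?thesis .
  qed
  have "I ^ (n - 2) \<le> ennreal ((\<alpha> + 2) ^ (2 * n)) * E ^ n"
  proof (cases "I = 0")
    case False
    then have "I ^ n \<noteq> 0" "I ^ n \<noteq> top" using \<open>I < top\<close> by (auto simp: power_less_top_ennreal less_top)
    then show ?thesis using main by (simp add: ennreal_mult_le_mult_iff)
  qed (use n in \<open>simp add: power_0_left\<close>)
  then show ?thesis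
    using n by (simp add: I_def E_def q_def \<alpha>(2) N_def n_def of_nat_diff)
qed

section \<open>Square integrable factors\<close>

lemma ennreal_tendsto_zero_of_power2:
  fixes f :: "'b \<Rightarrow> ennreal"
  assumes "((\<lambda>k. (f k)\<^sup>2) \<longlongrightarrow> 0) F" shows "(f \<longlongrightarrow> 0) F"
proof (rule order_tendstoI)
  fix a :: ennreal assume "0 < a"
  then have "0 < a\<^sup>2" by (simp add: zero_less_iff_neq_zero)
  then have "\<forall>\<^sub>F k in F. (f k)\<^sup>2 < a\<^sup>2" by (rule order_tendstoD(2)[OF assms])
  then show "\<forall>\<^sub>F k in F. f k < a"
    by eventually_elim (meson leD leI power_mono zero_le)
qed simp

lemma nn_integral_mult_tendsto_zero:
  fixes F :: "'a \<Rightarrow> ennreal" and Z :: "'b \<Rightarrow> 'a \<Rightarrow> ennreal"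
  assumes [measurable]: "F \<in> borel_measurable M" "\<And>k. Z k \<in> borel_measurable M"
    and F: "(\<integral>\<^sup>+x. (F x)\<^sup>2 \<partial>M) < \<infinity>" and Z: "((\<lambda>k. \<integral>\<^sup>+x. (Z k x)\<^sup>2 \<partial>M) \<longlongrightarrow> 0) G"
  shows "((\<lambda>k. \<integral>\<^sup>+x. F x * Z k x \<partial>M) \<longlongrightarrow> 0) G"
proof (rule ennreal_tendsto_zero_of_power2)
  have "((\<lambda>k. (\<integral>\<^sup>+x. (F x)\<^sup>2 \<partial>M) * (\<integral>\<^sup>+x. (Z k x)\<^sup>2 \<partial>M)) \<longlongrightarrow> (\<integral>\<^sup>+x. (F x)\<^sup>2 \<partial>M) * 0) G"
    using F by (intro tendsto_mult_ennreal tendsto_const Z) auto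
  then have lim: "((\<lambda>k. (\<integral>\<^sup>+x. (F x)\<^sup>2 \<partial>M) * (\<integral>\<^sup>+x. (Z k x)\<^sup>2 \<partial>M)) \<longlongrightarrow> 0) G" by simp
  show "((\<lambda>k. (\<integral>\<^sup>+x. F x * Z k x \<partial>M)\<^sup>2) \<longlongrightarrow> 0) G"
    by (rule tendsto_sandwich[OF _ _ tendsto_const lim])
      (auto intro!: always_eventually Cauchy_Schwarz_nn_integral)
qed

lemma nn_integral_mult_finite:
  fixes F Z :: "'a \<Rightarrow> ennreal"
  assumes [measurable]: "F \<in> borel_measurable M" "Z \<in> borel_measurable M"
    and F: "(\<integral>\<^sup>+x. (F x)\<^sup>2 \<partial>M) < \<infinity>" and Z: "(\<integral>\<^sup>+x. (Z x)\<^sup>2 \<partial>M) < \<infinity>"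
  shows "(\<integral>\<^sup>+x. F x * Z x \<partial>M) < \<infinity>"
proof -
  have "(\<integral>\<^sup>+x. F x * Z x \<partial>M)\<^sup>2 < \<infinity>"
    using Cauchy_Schwarz_nn_integral[of F M Z] F Z
    by (auto simp: ennreal_mult_less_top intro: le_less_trans)
  then show ?thesis by (simp add: power_less_top_ennreal)
qed

section \<open>Functions of class C1 supported in a set\<close>

text \<open>The class of functions to which the Sobolev inequality is applied. In contrast to test functions
  it names the gradient \<open>D\<close>, so closure under differences is immediate.\<close>

definition C1_supported :: "'a::euclidean_space set \<Rightarrow> ('a \<Rightarrow> real) \<Rightarrow> ('a \<Rightarrow> 'a) \<Rightarrow> bool" where
  "C1_supported \<Omega> f D \<longleftrightarrow> (\<forall>x. (f has_derivative (\<lambda>h. D x \<bullet> h)) (at x)) \<and> continuous_on UNIV D \<and>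
     (\<exists>R. \<forall>x. R < norm x \<longrightarrow> f x = 0 \<and> D x = 0) \<and> (\<forall>x. x \<notin> \<Omega> \<longrightarrow> f x = 0 \<and> D x = 0)"

lemma C1_supported_diff:
  assumes "C1_supported \<Omega> f D" "C1_supported \<Omega> g E"
  shows "C1_supported \<Omega> (\<lambda>x. f x - g x) (\<lambda>x. D x - E x)"
proof -
  obtain R S where R: "\<And>x. R < norm x \<Longrightarrow> f x = 0 \<and> D x = 0" and S: "\<And>x. S < norm x \<Longrightarrow> g x = 0 \<and> E x = 0"
    using assms unfolding C1_supported_def by metis
  have "\<exists>R. \<forall>x. R < norm x \<longrightarrow> f x - g x = 0 \<and> D x - E x = 0"
    by (rule exI[of _ "max R S"]) (use R S in auto)
  moreover have "((\<lambda>x. f x - g x) has_derivative (\<lambda>h. (D x - E x) \<bullet> h)) (at x)" for x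
    using assms unfolding C1_supported_def by (auto simp: inner_diff_left intro!: has_derivative_diff)
  moreover have "continuous_on UNIV (\<lambda>x. D x - E x)"
    using assms unfolding C1_supported_def by (auto intro!: continuous_intros)
  ultimately show ?thesis using assms unfolding C1_supported_def by auto
qed

lemma C1_supported_continuous:
  assumes "C1_supported \<Omega> f D" shows "continuous_on UNIV f" "continuous_on UNIV D"
  using assms unfolding C1_supported_def
  by (auto intro: continuous_at_imp_continuous_on has_derivative_continuous)

lemma C1_supported_measurable:
  fixes f :: "'a::euclidean_space \<Rightarrow> real"
  assumes "C1_supported \<Omega> f D"
  shows "f \<in> borel_measurable borel" "D \<in> borel_measurable borel"
    "f \<in> borel_measurable (lebesgue_on S)" "D \<in> borel_measurable (lebesgue_on S)"
  using C1_supported_continuous[OF assms]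
  by (auto intro!: borel_measurable_continuous_onI measurable_restrict_space1 measurable_completion)

lemma C1_supported_square_integrable:
  fixes f :: "'a::euclidean_space \<Rightarrow> real"
  assumes f: "C1_supported \<Omega> f D" and fin: "emeasure lebesgue \<Omega> < \<infinity>" and \<Omega>: "\<Omega> \<in> sets lebesgue"
  shows "(\<integral>\<^sup>+x. ennreal ((f x)\<^sup>2) \<partial>lebesgue_on \<Omega>) < \<infinity>"
    "(\<integral>\<^sup>+x. ennreal ((norm (D x))\<^sup>2) \<partial>lebesgue_on \<Omega>) < \<infinity>"
proof -
  have *: "(\<integral>\<^sup>+x. ennreal ((norm (g x))\<^sup>2) \<partial>lebesgue_on \<Omega>) < \<infinity>"
    if B: "\<And>x. norm (g x) \<le> B" for g :: "'a \<Rightarrow> 'b::real_normed_vector" and B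
  proof -
    have "(\<integral>\<^sup>+x. ennreal ((norm (g x))\<^sup>2) \<partial>lebesgue_on \<Omega>) \<le> (\<integral>\<^sup>+x. ennreal (B\<^sup>2) \<partial>lebesgue_on \<Omega>)"
      using B by (intro nn_integral_mono ennreal_leI power_mono) auto
    also have "\<dots> = ennreal (B\<^sup>2) * emeasure lebesgue \<Omega>"
      using \<Omega> by (simp add: emeasure_restrict_space)
    also have "\<dots> < \<infinity>" using fin by (auto simp: ennreal_mult_less_top)
    finally show ?thesis .
  qed
  obtain R where R: "\<And>x. R < norm x \<Longrightarrow> f x = 0 \<and> D x = 0"
    using f unfolding C1_supported_def by auto
  obtain B B' where "\<And>x. norm (f x) \<le> B" "\<And>x. norm (D x) \<le> B'"
    using bounded_support_imp_bounded[OF C1_supported_continuous(1)[OF f]]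
      bounded_support_imp_bounded[OF C1_supported_continuous(2)[OF f]] R by metis
  with *[of f B] *[of D B'] show "(\<integral>\<^sup>+x. ennreal ((f x)\<^sup>2) \<partial>lebesgue_on \<Omega>) < \<infinity>"
    "(\<integral>\<^sup>+x. ennreal ((norm (D x))\<^sup>2) \<partial>lebesgue_on \<Omega>) < \<infinity>" by auto
qed

lemma test_function_C1_supported:
  assumes "test_function \<Omega> \<phi>" shows "C1_supported \<Omega> \<phi> (grad \<phi>)"
proof -
  have C: "C_k (Suc 0) \<phi>" and cpt: "compact (closure {x. \<phi> x \<noteq> 0})"
    and sub: "closure {x. \<phi> x \<noteq> 0} \<subseteq> \<Omega>"
    using assms unfolding test_function_def by blast+
  have der: "(\<phi> has_derivative (\<lambda>h. grad \<phi> x \<bullet> h)) (at x)" for x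
  proof -
    have d: "(\<phi> has_derivative frechet_derivative \<phi> (at x)) (at x)"
      using C by (simp add: frechet_derivative_works)
    then interpret bounded_linear "frechet_derivative \<phi> (at x)" by (rule has_derivative_bounded_linear)
    have "frechet_derivative \<phi> (at x) h = grad \<phi> x \<bullet> h" for h
    proof -
      have "frechet_derivative \<phi> (at x) h = frechet_derivative \<phi> (at x) (\<Sum>i\<in>UNIV. (h $ i) *\<^sub>R axis i 1)"
        using basis_expansion[of h] by (simp add: scalar_mult_eq_scaleR)
      also have "\<dots> = grad \<phi> x \<bullet> h"
        by (simp add: sum scaleR grad_def inner_vec_def mult.commute)
      finally show ?thesis .
    qed
    then have "frechet_derivative \<phi> (at x) = (\<lambda>h. grad \<phi> x \<bullet> h)" by (rule ext)
    then show ?thesis using d by simp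
  qed
  have cont: "continuous_on UNIV (grad \<phi>)"
  proof -
    have "continuous_on UNIV (\<lambda>x. \<chi> i. grad \<phi> x $ i)"
      using C by (intro continuous_on_vec_lambda) simp
    then show ?thesis by simp
  qed
  have zero: "\<phi> x = 0 \<and> grad \<phi> x = 0" if "x \<notin> closure {x. \<phi> x \<noteq> 0}" for x
  proof -
    have "((\<lambda>_. 0) has_derivative (\<lambda>h. grad \<phi> x \<bullet> h)) (at x)"
      by (rule has_derivative_transform_within_open[OF der open_Compl[OF closed_closure]])
        (use that closure_subset[of "{x. \<phi> x \<noteq> 0}"] in auto)
    then have "(\<lambda>h. grad \<phi> x \<bullet> h) = (\<lambda>h. 0)"
      using has_derivative_unique has_derivative_const by blast
    then have "grad \<phi> x \<bullet> grad \<phi> x = 0" by metis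
    then show ?thesis using that closure_subset[of "{x. \<phi> x \<noteq> 0}"] by auto
  qed
  obtain R where R: "\<And>x. x \<in> closure {x. \<phi> x \<noteq> 0} \<Longrightarrow> norm x \<le> R"
    using cpt by (meson bounded_iff compact_imp_bounded)
  show ?thesis
    unfolding C1_supported_def using der cont zero R sub by (meson leD subsetD)
qed

lemma nn_integral_lebesgue_on_eq:
  fixes F :: "'a::euclidean_space \<Rightarrow> ennreal"
  assumes "\<Omega> \<in> sets lebesgue" "\<And>x. x \<notin> \<Omega> \<Longrightarrow> F x = 0"
  shows "(\<integral>\<^sup>+x. F x \<partial>lebesgue_on \<Omega>) = (\<integral>\<^sup>+x. F x \<partial>lborel)"
proof -
  have "(\<integral>\<^sup>+x. F x \<partial>lebesgue_on \<Omega>) = (\<integral>\<^sup>+x. F x * indicator \<Omega> x \<partial>lebesgue)"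
    using assms by (subst nn_integral_restrict_space) auto
  also have "\<dots> = (\<integral>\<^sup>+x. F x \<partial>lborel)"
    unfolding nn_integral_completion by (intro nn_integral_cong) (auto simp: indicator_def assms)
  finally show ?thesis .
qed

text \<open>The Hoelder inequality with \<open>n\<close> factors, two of them \<open>h powr (1/2)\<close> and \<open>n - 2\<close> of them
  \<open>\<bar>f\<bar> powr (2 / (n - 2))\<close>, separates the weight from \<open>f\<close>; the \<open>n\<close>-th power of the second kind of
  factor has the critical Sobolev exponent. The condition that the weight is in
  \<open>L\<^sup>n\<^sup>/\<^sup>2\<close> is exactly what the coefficients \<open>(norm b)\<^sup>2\<close>, \<open>(norm c)\<^sup>2\<close> and \<open>d\<close> provide.\<close>

lemma weighted_sobolev_C1:
  fixes h :: "'a::euclidean_space \<Rightarrow> real"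
  assumes dim: "3 \<le> DIM('a)" and \<Omega>: "\<Omega> \<in> sets lebesgue"
    and h[measurable]: "h \<in> borel_measurable (lebesgue_on \<Omega>)" and h0: "\<And>x. 0 \<le> h x"
    and hp: "(\<integral>\<^sup>+x. ennreal (h x powr (DIM('a) / 2)) \<partial>lebesgue_on \<Omega>) < \<infinity>"
  obtains C where "C < \<infinity>" "\<And>f D. C1_supported \<Omega> f D \<Longrightarrow>
    (\<integral>\<^sup>+x. ennreal (h x * (f x)\<^sup>2) \<partial>lebesgue_on \<Omega>) \<le> C * (\<integral>\<^sup>+x. ennreal ((norm (D x))\<^sup>2) \<partial>lebesgue_on \<Omega>)"
proof
  define n where "n = DIM('a)"
  have n: "3 \<le> n" using dim by (simp add: n_def)
  define q where "q = 2 * real n / (real n - 2)"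
  define H where "H = (\<integral>\<^sup>+x. ennreal (h x powr (n / 2)) \<partial>lebesgue_on \<Omega>)"
  define K where "K = ennreal ((2 * (n - 1) / (n - 2)) ^ (2 * n))"
  define C where "C = eroot n (H\<^sup>2 * K)"
  have H: "H < \<infinity>" using hp by (simp add: H_def n_def)
  have Cn: "C ^ n = H\<^sup>2 * K" unfolding C_def using n by (simp add: eroot_power)
  then have "C ^ n < top" using H by (simp add: K_def ennreal_mult_less_top power_less_top_ennreal)
  then show "C < \<infinity>" using n by (simp add: power_less_top_ennreal)
  fix f D assume f: "C1_supported \<Omega> f D"
  note [measurable] = C1_supported_measurable[OF f]
  define E where "E = (\<integral>\<^sup>+x. ennreal ((norm (D x))\<^sup>2) \<partial>lebesgue_on \<Omega>)"
  obtain R where R: "\<And>x. R < norm x \<Longrightarrow> f x = 0" using f unfolding C1_supported_def by auto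
  have off: "f x = 0" "D x = 0" if "x \<notin> \<Omega>" for x using that f unfolding C1_supported_def by auto
  define g where "g i x = (if i < 2 then ennreal (h x powr (1/2)) else ennreal (\<bar>f x\<bar> powr (2 / (real n - 2))))" for i :: nat and x
  have g[measurable]: "g i \<in> borel_measurable (lebesgue_on \<Omega>)" for i by (auto simp: g_def[abs_def])
  have split: "{..<n} = {0,1} \<union> {2..<n}" using n by auto
  have "(\<integral>\<^sup>+x. ennreal (h x * (f x)\<^sup>2) \<partial>lebesgue_on \<Omega>) = (\<integral>\<^sup>+x. (\<Prod>i<n. g i x) \<partial>lebesgue_on \<Omega>)"
  proof (intro nn_integral_cong)
    fix x
    have "(\<bar>f x\<bar> powr (2 / (real n - 2))) ^ (n - 2) = (f x)\<^sup>2"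
    proof (cases "f x = 0")
      case False
      then have "(\<bar>f x\<bar> powr (2 / (real n - 2))) ^ (n - 2) = \<bar>f x\<bar> powr (2 / (real n - 2) * real (n - 2))"
        by (subst powr_realpow[symmetric]) (simp, rule powr_powr)
      also have "2 / (real n - 2) * real (n - 2) = 2" using n by (simp add: field_simps)
      finally show ?thesis using False by (simp add: powr_numeral)
    qed (use n in \<open>auto simp: power_0_left\<close>)
    moreover have "h x powr (1/2) * h x powr (1/2) = h x"
      using h0[of x] by (simp add: powr_add[symmetric])
    ultimately have "ennreal (h x powr (1/2)) * ennreal (h x powr (1/2)) * ennreal (\<bar>f x\<bar> powr (2 / (real n - 2))) ^ (n - 2) = ennreal (h x * (f x)\<^sup>2)"
      using h0[of x] by (simp add: ennreal_power flip: ennreal_mult)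
    moreover have "(\<Prod>i<n. g i x) = ennreal (h x powr (1/2)) * ennreal (h x powr (1/2)) * ennreal (\<bar>f x\<bar> powr (2 / (real n - 2))) ^ (n - 2)"
      unfolding split by (subst prod.union_disjoint) (auto simp: g_def mult.assoc)
    ultimately show "ennreal (h x * (f x)\<^sup>2) = (\<Prod>i<n. g i x)" by simp
  qed
  then have "(\<integral>\<^sup>+x. ennreal (h x * (f x)\<^sup>2) \<partial>lebesgue_on \<Omega>) ^ n \<le> (\<Prod>i<n. \<integral>\<^sup>+x. g i x ^ n \<partial>lebesgue_on \<Omega>)"
    using nn_integral_prod_power_le[of "{..<n}" g "lebesgue_on \<Omega>"] n by (auto simp: lessThan_empty_iff)
  also have "\<dots> = H\<^sup>2 * (\<integral>\<^sup>+x. ennreal (\<bar>f x\<bar> powr q) \<partial>lebesgue_on \<Omega>) ^ (n - 2)"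
  proof -
    have "(h x powr (1/2)) ^ n = h x powr (n / 2)" for x
      using h0[of x] n by (cases "h x = 0") (auto simp: powr_realpow[symmetric] powr_powr power_0_left)
    moreover have "(\<bar>f x\<bar> powr (2 / (real n - 2))) ^ n = \<bar>f x\<bar> powr q" for x
      using n by (cases "f x = 0") (auto simp: powr_realpow[symmetric] powr_powr power_0_left q_def)
    ultimately show ?thesis
      unfolding split
      by (subst prod.union_disjoint) (auto simp: g_def H_def ennreal_power power2_eq_square)
  qed
  also have "(\<integral>\<^sup>+x. ennreal (\<bar>f x\<bar> powr q) \<partial>lebesgue_on \<Omega>) ^ (n - 2) \<le> K * E ^ n"
  proof -
    have "(\<integral>\<^sup>+x. ennreal (\<bar>f x\<bar> powr q) \<partial>lebesgue_on \<Omega>) = (\<integral>\<^sup>+x. ennreal (\<bar>f x\<bar> powr q) \<partial>lborel)"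
      using off by (intro nn_integral_lebesgue_on_eq \<Omega>) (auto simp: q_def)
    moreover have "E = (\<integral>\<^sup>+x. ennreal ((norm (D x))\<^sup>2) \<partial>lborel)"
      unfolding E_def using off by (intro nn_integral_lebesgue_on_eq \<Omega>) auto
    moreover have "real (n - Suc 0) = real n - 1" "real (n - 2) = real n - 2" using n by auto
    ultimately show ?thesis
      using sobolev_C1[OF dim, of f D R] f R by (simp add: C1_supported_def n_def[symmetric] K_def q_def)
  qed
  also have "H\<^sup>2 * (K * E ^ n) = (C * E) ^ n" by (simp add: power_mult_distrib Cn mult.assoc)
  finally show "(\<integral>\<^sup>+x. ennreal (h x * (f x)\<^sup>2) \<partial>lebesgue_on \<Omega>) \<le> C * E"
    using n by (simp add: ennreal_power_mono_iff mult_left_mono)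
qed

section \<open>Approximation in the closure of the test functions\<close>

lemma nn_integral_norm_diff_squared_le:
  fixes f g :: "'a \<Rightarrow> 'b::euclidean_space"
  assumes [measurable]: "f \<in> borel_measurable M" "g \<in> borel_measurable M" "w \<in> borel_measurable M"
    and w: "\<And>x. 0 \<le> (w x :: real)"
  shows "(\<integral>\<^sup>+x. ennreal (w x * (norm (f x - g x))\<^sup>2) \<partial>M)
    \<le> 2 * (\<integral>\<^sup>+x. ennreal (w x * (norm (f x))\<^sup>2) \<partial>M) + 2 * (\<integral>\<^sup>+x. ennreal (w x * (norm (g x))\<^sup>2) \<partial>M)"
proof -
  have "(\<integral>\<^sup>+x. ennreal (w x * (norm (f x - g x))\<^sup>2) \<partial>M)
    \<le> (\<integral>\<^sup>+x. 2 * ennreal (w x * (norm (f x))\<^sup>2) + 2 * ennreal (w x * (norm (g x))\<^sup>2) \<partial>M)"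
  proof (intro nn_integral_mono)
    fix x
    have "(norm (f x - g x))\<^sup>2 \<le> (norm (f x) + norm (g x))\<^sup>2"
      by (intro power_mono norm_triangle_ineq4) auto
    also have "\<dots> \<le> 2 * (norm (f x))\<^sup>2 + 2 * (norm (g x))\<^sup>2"
      using sum_squares_bound[of "norm (f x)" "norm (g x)"] by (simp add: power2_sum)
    finally have "w x * (norm (f x - g x))\<^sup>2 \<le> w x * (2 * (norm (f x))\<^sup>2 + 2 * (norm (g x))\<^sup>2)"
      by (intro mult_left_mono w)
    also have "\<dots> = 2 * (w x * (norm (f x))\<^sup>2) + 2 * (w x * (norm (g x))\<^sup>2)"
      by (simp add: algebra_simps)
    finally have "ennreal (w x * (norm (f x - g x))\<^sup>2) \<le> ennreal (2 * (w x * (norm (f x))\<^sup>2) + 2 * (w x * (norm (g x))\<^sup>2))"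
      by (rule ennreal_leI)
    then show "ennreal (w x * (norm (f x - g x))\<^sup>2) \<le> 2 * ennreal (w x * (norm (f x))\<^sup>2) + 2 * ennreal (w x * (norm (g x))\<^sup>2)"
      using w by (simp add: ennreal_plus ennreal_mult)
  qed
  also have "\<dots> = 2 * (\<integral>\<^sup>+x. ennreal (w x * (norm (f x))\<^sup>2) \<partial>M) + 2 * (\<integral>\<^sup>+x. ennreal (w x * (norm (g x))\<^sup>2) \<partial>M)"
    by (simp add: nn_integral_add nn_integral_cmult)
  finally show ?thesis .
qed

lemma Lp_on_2_iff:
  "Lp_on \<Omega> 2 f \<longleftrightarrow> f \<in> borel_measurable (lebesgue_on \<Omega>) \<and> (\<integral>\<^sup>+x. ennreal ((norm (f x))\<^sup>2) \<partial>lebesgue_on \<Omega>) < \<infinity>"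
  unfolding Lp_on_def by (auto simp: integrable_iff_bounded powr_numeral)

text \<open>The Bochner integral of a function that is not integrable is 0, so convergence of these integrals
  in the definition of the space says something only because the integrands are integrable. With that
  checked, the two parts of the norm can be separated and expressed by nonnegative integrals.\<close>

lemma W12_0_approx:
  fixes u :: "real^'n \<Rightarrow> real"
  assumes W: "W12_0 \<Omega> u Du" and \<Omega>: "\<Omega> \<in> sets lebesgue" "emeasure lebesgue \<Omega> < \<infinity>"
  obtains \<phi> where "\<And>k. test_function \<Omega> (\<phi> k)"
    "(\<lambda>k. \<integral>\<^sup>+x. ennreal ((\<phi> k x - u x)\<^sup>2) \<partial>lebesgue_on \<Omega>) \<longlonglongrightarrow> 0"
    "(\<lambda>k. \<integral>\<^sup>+x. ennreal ((norm (grad (\<phi> k) x - Du x))\<^sup>2) \<partial>lebesgue_on \<Omega>) \<longlonglongrightarrow> 0"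
proof -
  let ?M = "lebesgue_on \<Omega>"
  obtain \<phi> where \<phi>: "\<And>k. test_function \<Omega> (\<phi> k)"
    and lim: "(\<lambda>k. LINT x|?M. (\<phi> k x - u x)\<^sup>2 + (norm (grad (\<phi> k) x - Du x))\<^sup>2) \<longlonglongrightarrow> 0"
    using W unfolding W12_0_def by auto
  have u: "Lp_on \<Omega> 2 u" "Lp_on \<Omega> 2 Du" using W unfolding W12_0_def W12_def by auto
  then have [measurable]: "u \<in> borel_measurable ?M" "Du \<in> borel_measurable ?M" by (auto simp: Lp_on_def)
  note \<phi>C = test_function_C1_supported[OF \<phi>]
  note [measurable] = C1_supported_measurable(3,4)[OF \<phi>C]
  note sq = C1_supported_square_integrable[OF \<phi>C \<Omega>(2,1)]
  have fin: "(\<integral>\<^sup>+x. ennreal ((\<phi> k x - u x)\<^sup>2) \<partial>?M) < \<infinity>"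
      "(\<integral>\<^sup>+x. ennreal ((norm (grad (\<phi> k) x - Du x))\<^sup>2) \<partial>?M) < \<infinity>" for k
    using nn_integral_norm_diff_squared_le[of "\<phi> k" ?M u "\<lambda>_. 1"]
      nn_integral_norm_diff_squared_le[of "grad (\<phi> k)" ?M Du "\<lambda>_. 1"] sq[of k] u
    by (auto simp: Lp_on_2_iff ennreal_mult_less_top elim!: le_less_trans)
  have eq: "ennreal (LINT x|?M. (\<phi> k x - u x)\<^sup>2 + (norm (grad (\<phi> k) x - Du x))\<^sup>2)
      = (\<integral>\<^sup>+x. ennreal ((\<phi> k x - u x)\<^sup>2) \<partial>?M) + (\<integral>\<^sup>+x. ennreal ((norm (grad (\<phi> k) x - Du x))\<^sup>2) \<partial>?M)" for k
  proof -
    have s: "(\<integral>\<^sup>+x. ennreal ((\<phi> k x - u x)\<^sup>2 + (norm (grad (\<phi> k) x - Du x))\<^sup>2) \<partial>?M)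
      = (\<integral>\<^sup>+x. ennreal ((\<phi> k x - u x)\<^sup>2) \<partial>?M) + (\<integral>\<^sup>+x. ennreal ((norm (grad (\<phi> k) x - Du x))\<^sup>2) \<partial>?M)"
      by (simp add: ennreal_plus nn_integral_add)
    have "integrable ?M (\<lambda>x. (\<phi> k x - u x)\<^sup>2 + (norm (grad (\<phi> k) x - Du x))\<^sup>2)"
      by (rule integrableI_nonneg) (use s fin[of k] in auto)
    then show ?thesis unfolding s[symmetric] by (intro nn_integral_eq_integral[symmetric]) auto
  qed
  have "(\<lambda>k. ennreal (LINT x|?M. (\<phi> k x - u x)\<^sup>2 + (norm (grad (\<phi> k) x - Du x))\<^sup>2)) \<longlonglongrightarrow> 0"
    using tendsto_ennrealI[OF lim] by simp
  then have lim': "(\<lambda>k. (\<integral>\<^sup>+x. ennreal ((\<phi> k x - u x)\<^sup>2) \<partial>?M) + (\<integral>\<^sup>+x. ennreal ((norm (grad (\<phi> k) x - Du x))\<^sup>2) \<partial>?M)) \<longlonglongrightarrow> 0"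
    unfolding eq .
  show ?thesis
      proof (rule that[of \<phi>])
    show "(\<lambda>k. \<integral>\<^sup>+x. ennreal ((\<phi> k x - u x)\<^sup>2) \<partial>?M) \<longlonglongrightarrow> 0"
      by (rule tendsto_sandwich[OF _ _ tendsto_const lim']) (auto intro!: always_eventually)
    show "(\<lambda>k. \<integral>\<^sup>+x. ennreal ((norm (grad (\<phi> k) x - Du x))\<^sup>2) \<partial>?M) \<longlonglongrightarrow> 0"
      by (rule tendsto_sandwich[OF _ _ tendsto_const lim']) (auto intro!: always_eventually)
  qed (rule \<phi>)
qed

lemma tendsto_L2_AE_subseq:
  fixes f :: "nat \<Rightarrow> 'a \<Rightarrow> real"
  assumes [measurable]: "\<And>k. f k \<in> borel_measurable M"
    and lim: "(\<lambda>k. \<integral>\<^sup>+x. ennreal ((f k x)\<^sup>2) \<partial>M) \<longlonglongrightarrow> 0"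
  obtains r :: "nat \<Rightarrow> nat" where "strict_mono r" "AE x in M. (\<lambda>k. f (r k) x) \<longlonglongrightarrow> 0"
proof -
  \<comment> \<open>finitely many of the integrals may be infinite, hence the shift by \<open>N\<close>\<close>
  obtain N where N: "\<And>k. N \<le> k \<Longrightarrow> (\<integral>\<^sup>+x. ennreal ((f k x)\<^sup>2) \<partial>M) < 1"
    using order_tendstoD(2)[OF lim, of 1] by (auto simp: eventually_sequentially)
  define g where "g k x = (f (k + N) x)\<^sup>2" for k x
  have [measurable]: "g k \<in> borel_measurable M" for k by (auto simp: g_def[abs_def])
  have int: "integrable M (g k)" for k
    by (rule integrableI_nonneg) (use N[of "k + N"] in \<open>auto simp: g_def intro: less_trans\<close>)
  have "(\<lambda>k. ennreal (LINT x|M. norm (g k x))) \<longlonglongrightarrow> 0"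
  proof -
    have "ennreal (LINT x|M. norm (g k x)) = (\<integral>\<^sup>+x. ennreal ((f (k + N) x)\<^sup>2) \<partial>M)" for k
      using nn_integral_eq_integral[OF int[of k]] by (simp add: g_def[abs_def])
    then show ?thesis using LIMSEQ_ignore_initial_segment[OF lim, of N] by simp
  qed
  then have "(\<lambda>k. LINT x|M. norm (g k x)) \<longlonglongrightarrow> 0"
    by (subst (asm) ennreal_0[symmetric], subst (asm) tendsto_ennreal_iff) auto
  from tendsto_L1_AE_subseq[OF int this] obtain s :: "nat \<Rightarrow> nat"
    where s: "strict_mono s" "AE x in M. (\<lambda>k. g (s k) x) \<longlonglongrightarrow> 0" by auto
  show ?thesis
  proof
    show "strict_mono (\<lambda>k. s k + N)" using s(1) by (auto simp: strict_mono_def)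
    show "AE x in M. (\<lambda>k. f (s k + N) x) \<longlonglongrightarrow> 0"
      using s(2)
    proof eventually_elim
      case (elim x)
      then have "(\<lambda>k. sqrt ((f (s k + N) x)\<^sup>2)) \<longlonglongrightarrow> sqrt 0"
        unfolding g_def by (rule tendsto_real_sqrt)
      then show ?case by (simp add: tendsto_rabs_zero_iff)
    qed
  qed
qed

text \<open>The weighted inequality holds only for functions of class C1, hence for the differences
  \<open>\<phi> k - \<phi> j\<close>. Letting \<open>j\<close> run through a subsequence with \<open>\<phi> j \<longlonglongrightarrow> u\<close> almost everywhere,
  Fatou's lemma carries the bound over to \<open>\<phi> k - u\<close>.\<close>

lemma weighted_L2_tendsto:
  fixes \<phi> :: "nat \<Rightarrow> 'a::euclidean_space \<Rightarrow> real"
  assumes C: "C < \<infinity>" "\<And>f D. C1_supported \<Omega> f D \<Longrightarrow>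
      (\<integral>\<^sup>+x. ennreal (h x * (f x)\<^sup>2) \<partial>lebesgue_on \<Omega>) \<le> C * (\<integral>\<^sup>+x. ennreal ((norm (D x))\<^sup>2) \<partial>lebesgue_on \<Omega>)"
    and h[measurable]: "h \<in> borel_measurable (lebesgue_on \<Omega>)" and h0: "\<And>x. 0 \<le> h x"
    and \<phi>: "\<And>k. C1_supported \<Omega> (\<phi> k) (D\<phi> k)"
    and [measurable]: "u \<in> borel_measurable (lebesgue_on \<Omega>)" "Du \<in> borel_measurable (lebesgue_on \<Omega>)"
    and lim: "(\<lambda>k. \<integral>\<^sup>+x. ennreal ((\<phi> k x - u x)\<^sup>2) \<partial>lebesgue_on \<Omega>) \<longlonglongrightarrow> 0"
      "(\<lambda>k. \<integral>\<^sup>+x. ennreal ((norm (D\<phi> k x - Du x))\<^sup>2) \<partial>lebesgue_on \<Omega>) \<longlonglongrightarrow> 0"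
  shows "(\<lambda>k. \<integral>\<^sup>+x. ennreal (h x * (\<phi> k x - u x)\<^sup>2) \<partial>lebesgue_on \<Omega>) \<longlonglongrightarrow> 0"
proof -
  let ?M = "lebesgue_on \<Omega>"
  define e where "e k = (\<integral>\<^sup>+x. ennreal ((norm (D\<phi> k x - Du x))\<^sup>2) \<partial>?M)" for k
  note [measurable] = C1_supported_measurable(3,4)[OF \<phi>]
  obtain r :: "nat \<Rightarrow> nat" where r: "strict_mono r" "AE x in ?M. (\<lambda>k. \<phi> (r k) x - u x) \<longlonglongrightarrow> 0"
    using tendsto_L2_AE_subseq[of "\<lambda>k x. \<phi> k x - u x" ?M] lim(1) by auto
  have e: "(\<lambda>j. e (r j)) \<longlonglongrightarrow> 0"
    using LIMSEQ_subseq_LIMSEQ[OF lim(2) r(1)] by (simp add: e_def o_def)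
  have bound: "(\<integral>\<^sup>+x. ennreal (h x * (\<phi> k x - u x)\<^sup>2) \<partial>?M) \<le> C * (2 * e k)" for k
  proof -
    have "(\<integral>\<^sup>+x. ennreal (h x * (\<phi> k x - u x)\<^sup>2) \<partial>?M)
        = (\<integral>\<^sup>+x. liminf (\<lambda>j. ennreal (h x * (\<phi> k x - \<phi> (r j) x)\<^sup>2)) \<partial>?M)"
    proof (intro nn_integral_cong_AE, use r(2) in eventually_elim)
      case (elim x)
      then have "(\<lambda>j. \<phi> (r j) x) \<longlonglongrightarrow> u x" by (simp add: LIM_zero_iff)
      then have "(\<lambda>j. ennreal (h x * (\<phi> k x - \<phi> (r j) x)\<^sup>2)) \<longlonglongrightarrow> ennreal (h x * (\<phi> k x - u x)\<^sup>2)"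
        by (intro tendsto_ennrealI tendsto_intros)
      then show ?case by (simp add: lim_imp_Liminf)
    qed
    also have "\<dots> \<le> liminf (\<lambda>j. \<integral>\<^sup>+x. ennreal (h x * (\<phi> k x - \<phi> (r j) x)\<^sup>2) \<partial>?M)"
      by (intro nn_integral_liminf) auto
    also have "\<dots> \<le> liminf (\<lambda>j. C * (2 * e k + 2 * e (r j)))"
    proof (intro Liminf_mono always_eventually allI)
      fix j
      have "(\<integral>\<^sup>+x. ennreal (h x * (\<phi> k x - \<phi> (r j) x)\<^sup>2) \<partial>?M)
          \<le> C * (\<integral>\<^sup>+x. ennreal ((norm (D\<phi> k x - D\<phi> (r j) x))\<^sup>2) \<partial>?M)"
        by (intro C(2) C1_supported_diff \<phi>)
      also have "(\<integral>\<^sup>+x. ennreal ((norm (D\<phi> k x - D\<phi> (r j) x))\<^sup>2) \<partial>?M) \<le> 2 * e k + 2 * e (r j)"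
        using nn_integral_norm_diff_squared_le[of "\<lambda>x. D\<phi> k x - Du x" ?M "\<lambda>x. D\<phi> (r j) x - Du x" "\<lambda>_. 1"]
        by (simp add: e_def)
      finally show "(\<integral>\<^sup>+x. ennreal (h x * (\<phi> k x - \<phi> (r j) x)\<^sup>2) \<partial>?M) \<le> C * (2 * e k + 2 * e (r j))"
        by (auto simp: mult_left_mono)
    qed
    also have "\<dots> = C * (2 * e k + 2 * 0)"
      using C(1) e by (intro lim_imp_Liminf ennreal_tendsto_cmult tendsto_add tendsto_const) auto
    finally show ?thesis by simp
  qed
  have "(\<lambda>k. C * (2 * e k)) \<longlonglongrightarrow> C * (2 * 0)"
    using C(1) lim(2) by (intro ennreal_tendsto_cmult) (auto simp: e_def)
  then have lim_e: "(\<lambda>k. C * (2 * e k)) \<longlonglongrightarrow> 0" by simp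
  show ?thesis
    by (rule tendsto_sandwich[OF _ _ tendsto_const lim_e]) (auto intro!: always_eventually bound)
qed

text \<open>With a weight \<open>h\<close> that dominates \<open>(norm b)\<^sup>2\<close>, \<open>(norm c)\<^sup>2\<close> and \<open>\<bar>d\<bar>\<close>, all four terms of the
  bilinear form are bounded at once by a product of two such densities, one for each argument.\<close>

definition energy :: "('a \<Rightarrow> real) \<Rightarrow> ('a \<Rightarrow> real) \<Rightarrow> ('a \<Rightarrow> 'b::real_normed_vector) \<Rightarrow> 'a \<Rightarrow> real" where
  "energy h u Du x = norm (Du x) + sqrt (h x) * \<bar>u x\<bar>"

lemma nn_integral_energy_squared_le:
  fixes Du :: "'a \<Rightarrow> 'b::euclidean_space"
  assumes [measurable]: "h \<in> borel_measurable M" "u \<in> borel_measurable M" "Du \<in> borel_measurable M"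
    and h: "\<And>x. 0 \<le> h x"
  shows "(\<integral>\<^sup>+x. (ennreal (energy h u Du x))\<^sup>2 \<partial>M)
    \<le> 2 * (\<integral>\<^sup>+x. ennreal ((norm (Du x))\<^sup>2) \<partial>M) + 2 * (\<integral>\<^sup>+x. ennreal (h x * (u x)\<^sup>2) \<partial>M)"
proof -
  have "(\<integral>\<^sup>+x. (ennreal (energy h u Du x))\<^sup>2 \<partial>M)
    = (\<integral>\<^sup>+x. ennreal (1 * (norm (norm (Du x) - (- (sqrt (h x) * \<bar>u x\<bar>))))\<^sup>2) \<partial>M)"
    using h by (intro nn_integral_cong) (subst ennreal_power, auto simp: energy_def)
  also have "\<dots> \<le> 2 * (\<integral>\<^sup>+x. ennreal (1 * (norm (norm (Du x)))\<^sup>2) \<partial>M) + 2 * (\<integral>\<^sup>+x. ennreal (1 * (norm (- (sqrt (h x) * \<bar>u x\<bar>)))\<^sup>2) \<partial>M)"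
    by (rule nn_integral_norm_diff_squared_le) auto
  also have "\<dots> = 2 * (\<integral>\<^sup>+x. ennreal ((norm (Du x))\<^sup>2) \<partial>M) + 2 * (\<integral>\<^sup>+x. ennreal (h x * (u x)\<^sup>2) \<partial>M)"
    using h by (simp add: power_mult_distrib)
  finally show ?thesis .
qed

section \<open>The bilinear form of the operator\<close>

definition form_density ::
  "(real^'n \<Rightarrow> real^'n^'n) \<Rightarrow> (real^'n \<Rightarrow> real^'n) \<Rightarrow> (real^'n \<Rightarrow> real^'n) \<Rightarrow> (real^'n \<Rightarrow> real) \<Rightarrow>
   (real^'n \<Rightarrow> real) \<Rightarrow> (real^'n \<Rightarrow> real^'n) \<Rightarrow> (real^'n \<Rightarrow> real) \<Rightarrow> (real^'n \<Rightarrow> real^'n) \<Rightarrow> real^'n \<Rightarrow> real" where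
  "form_density A b c d v Dv u Du x =
     (A x *v Dv x) \<bullet> Du x + (b x \<bullet> Du x) * v x + (c x \<bullet> Dv x) * u x + d x * v x * u x"

lemma form_density_transpose:
  "form_density (\<lambda>x. transpose (A x)) c b d u Du v Dv x = form_density A b c d v Dv u Du x"
proof -
  have "(transpose (A x) *v Du x) \<bullet> Dv x = (A x *v Dv x) \<bullet> Du x"
    by (metis dot_lmul_matrix inner_commute transpose_matrix_vector)
  then show ?thesis by (simp add: form_density_def mult_ac)
qed

lemma form_density_diff:
  "form_density A b c d v Dv (\<lambda>x. f x - u x) (\<lambda>x. Df x - Du x) x
    = form_density A b c d v Dv f Df x - form_density A b c d v Dv u Du x"
  by (simp add: form_density_def inner_diff_right algebra_simps)

lemma borel_measurable_vec_component [measurable (raw)]: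
  fixes f :: "'a \<Rightarrow> 'b::euclidean_space^'n"
  assumes "f \<in> borel_measurable M" shows "(\<lambda>x. f x $ i) \<in> borel_measurable M"
proof -
  have "(\<lambda>v::'b^'n. v $ i) \<in> borel_measurable borel"
    by (intro borel_measurable_continuous_onI continuous_intros)
  from measurable_compose[OF assms this] show ?thesis .
qed

lemma borel_measurable_form_density:
  assumes [measurable]: "A \<in> borel_measurable M" "b \<in> borel_measurable M" "c \<in> borel_measurable M"
    "d \<in> borel_measurable M" "v \<in> borel_measurable M" "Dv \<in> borel_measurable M"
    "u \<in> borel_measurable M" "Du \<in> borel_measurable M"
  shows "form_density A b c d v Dv u Du \<in> borel_measurable M"
proof -
  have "(A x *v Dv x) \<bullet> Du x = (\<Sum>i\<in>UNIV. (\<Sum>j\<in>UNIV. A x $ i $ j * Dv x $ j) * Du x $ i)" for x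
    by (simp add: inner_vec_def matrix_vector_mult_def)
  then show ?thesis unfolding form_density_def[abs_def] by simp
qed

lemma abs_form_density_le:
  assumes K: "\<And>\<xi>. norm (A x *v \<xi>) \<le> K * norm \<xi>" "0 \<le> K"
    and h: "(norm (b x))\<^sup>2 \<le> h x" "(norm (c x))\<^sup>2 \<le> h x" "\<bar>d x\<bar> \<le> h x"
  shows "\<bar>form_density A b c d v Dv u Du x\<bar> \<le> (K + 1) * (energy h v Dv x * energy h u Du x)"
proof -
  define s where "s = sqrt (h x)"
  have h0: "0 \<le> h x" using h(3) by linarith
  have s: "0 \<le> s" "norm (b x) \<le> s" "norm (c x) \<le> s" "\<bar>d x\<bar> \<le> s * s"
    using h h0 by (auto simp: s_def real_le_rsqrt)
  have "\<bar>(A x *v Dv x) \<bullet> Du x\<bar> \<le> K * (norm (Dv x) * norm (Du x))"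
    using Cauchy_Schwarz_ineq2[of "A x *v Dv x" "Du x"] mult_right_mono[OF K(1)[of "Dv x"], of "norm (Du x)"]
    by simp
  moreover have "\<bar>(b x \<bullet> Du x) * v x\<bar> \<le> (s * \<bar>v x\<bar>) * norm (Du x)"
    using Cauchy_Schwarz_ineq2[of "b x" "Du x"] mult_right_mono[OF s(2), of "norm (Du x)"]
      mult_right_mono[of "\<bar>b x \<bullet> Du x\<bar>" "s * norm (Du x)" "\<bar>v x\<bar>"]
    by (simp add: abs_mult mult_ac)
  moreover have "\<bar>(c x \<bullet> Dv x) * u x\<bar> \<le> norm (Dv x) * (s * \<bar>u x\<bar>)"
    using Cauchy_Schwarz_ineq2[of "c x" "Dv x"] mult_right_mono[OF s(3), of "norm (Dv x)"]
      mult_right_mono[of "\<bar>c x \<bullet> Dv x\<bar>" "s * norm (Dv x)" "\<bar>u x\<bar>"]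
    by (simp add: abs_mult mult_ac)
  moreover have "\<bar>d x * v x * u x\<bar> \<le> (s * \<bar>v x\<bar>) * (s * \<bar>u x\<bar>)"
    using mult_right_mono[OF s(4), of "\<bar>v x\<bar> * \<bar>u x\<bar>"] by (simp add: abs_mult mult_ac)
  ultimately have "\<bar>form_density A b c d v Dv u Du x\<bar>
      \<le> K * (norm (Dv x) * norm (Du x)) + (s * \<bar>v x\<bar>) * norm (Du x) + norm (Dv x) * (s * \<bar>u x\<bar>) + (s * \<bar>v x\<bar>) * (s * \<bar>u x\<bar>)"
    unfolding form_density_def by linarith
  also have "\<dots> \<le> (K + 1) * ((norm (Dv x) + s * \<bar>v x\<bar>) * (norm (Du x) + s * \<bar>u x\<bar>))"
  proof -
    have "0 \<le> K * ((s * \<bar>v x\<bar>) * norm (Du x) + norm (Dv x) * (s * \<bar>u x\<bar>) + (s * \<bar>v x\<bar>) * (s * \<bar>u x\<bar>))"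
      using K(2) s(1) by (intro mult_nonneg_nonneg add_nonneg_nonneg) auto
    moreover have "0 \<le> norm (Dv x) * norm (Du x)" by simp
    ultimately show ?thesis by (simp add: algebra_simps)
  qed
  finally show ?thesis by (simp add: energy_def s_def)
qed

section \<open>Testing a weak solution with functions of the Sobolev space\<close>

lemma integral_tendsto_of_energy_bound:
  fixes T :: "nat \<Rightarrow> 'a \<Rightarrow> real" and F :: "'a \<Rightarrow> real"
  assumes int: "\<And>k. integrable M (T k)" "integrable M T'"
    and [measurable]: "F \<in> borel_measurable M" "\<And>k. Z k \<in> borel_measurable M"
    and F: "(\<integral>\<^sup>+x. (ennreal (F x))\<^sup>2 \<partial>M) < \<infinity>"
    and Z: "(\<lambda>k. \<integral>\<^sup>+x. (ennreal (Z k x))\<^sup>2 \<partial>M) \<longlonglongrightarrow> 0"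
    and nn: "\<And>x. 0 \<le> F x" "\<And>k x. 0 \<le> Z k x" "0 \<le> K"
    and le: "\<And>k x. x \<in> space M \<Longrightarrow> \<bar>T k x - T' x\<bar> \<le> K * (F x * Z k x)"
  shows "(\<lambda>k. LINT x|M. T k x) \<longlonglongrightarrow> (LINT x|M. T' x)"
proof (rule tendsto_L1_int[OF int])
  have "(\<lambda>k. ennreal K * (\<integral>\<^sup>+x. ennreal (F x) * ennreal (Z k x) \<partial>M)) \<longlonglongrightarrow> ennreal K * 0"
    by (intro ennreal_tendsto_cmult nn_integral_mult_tendsto_zero F Z) auto
  then have lim: "(\<lambda>k. ennreal K * (\<integral>\<^sup>+x. ennreal (F x) * ennreal (Z k x) \<partial>M)) \<longlonglongrightarrow> 0" by simp
  have "(\<integral>\<^sup>+x. norm (T k x - T' x) \<partial>M) \<le> ennreal K * (\<integral>\<^sup>+x. ennreal (F x) * ennreal (Z k x) \<partial>M)" for k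
  proof -
    have "(\<integral>\<^sup>+x. norm (T k x - T' x) \<partial>M) \<le> (\<integral>\<^sup>+x. ennreal K * (ennreal (F x) * ennreal (Z k x)) \<partial>M)"
      using le nn by (intro nn_integral_mono) (simp add: ennreal_mult[symmetric] ennreal_leI)
    then show ?thesis by (simp add: nn_integral_cmult)
  qed
  then show "(\<lambda>k. \<integral>\<^sup>+x. norm (T k x - T' x) \<partial>M) \<longlonglongrightarrow> 0"
    by (intro tendsto_sandwich[OF _ _ tendsto_const lim]) (auto intro!: always_eventually)
qed

lemma integrable_of_energy_bound:
  fixes T F Z :: "'a \<Rightarrow> real"
  assumes [measurable]: "T \<in> borel_measurable M" "F \<in> borel_measurable M" "Z \<in> borel_measurable M"
    and F: "(\<integral>\<^sup>+x. (ennreal (F x))\<^sup>2 \<partial>M) < \<infinity>" "(\<integral>\<^sup>+x. (ennreal (Z x))\<^sup>2 \<partial>M) < \<infinity>"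
    and nn: "\<And>x. 0 \<le> F x" "\<And>x. 0 \<le> Z x" "0 \<le> K"
    and le: "\<And>x. x \<in> space M \<Longrightarrow> \<bar>T x\<bar> \<le> K * (F x * Z x)"
  shows "integrable M T"
proof (rule integrableI_bounded)
  have "(\<integral>\<^sup>+x. norm (T x) \<partial>M) \<le> (\<integral>\<^sup>+x. ennreal K * (ennreal (F x) * ennreal (Z x)) \<partial>M)"
    using le nn by (intro nn_integral_mono) (simp add: ennreal_mult[symmetric] ennreal_leI)
  also have "\<dots> = ennreal K * (\<integral>\<^sup>+x. ennreal (F x) * ennreal (Z x) \<partial>M)"
    by (simp add: nn_integral_cmult)
  also have "\<dots> < \<infinity>"
    using nn_integral_mult_finite[of "\<lambda>x. ennreal (F x)" M "\<lambda>x. ennreal (Z x)"] F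
    by (simp add: ennreal_mult_less_top)
  finally show "(\<integral>\<^sup>+x. norm (T x) \<partial>M) < \<infinity>" .
qed simp

text \<open>The weight \<open>h\<close> and the constant \<open>C\<close> of its Sobolev inequality are parameters, because the same
  pair serves the operator and its transpose. The lower bound \<open>1 \<le> h\<close> makes the energy density
  dominate \<open>\<bar>u\<bar>\<close> as well, which is what the right-hand side of the equation needs.\<close>

locale drift_form =
  fixes \<Omega> :: "(real^'n) set" and A :: "real^'n \<Rightarrow> real^'n^'n" and b c :: "real^'n \<Rightarrow> real^'n"
    and d h :: "real^'n \<Rightarrow> real" and K :: real and C :: ennreal
  assumes \<Omega>: "\<Omega> \<in> sets lebesgue" "emeasure lebesgue \<Omega> < \<infinity>"
    and meas: "A \<in> borel_measurable (lebesgue_on \<Omega>)" "b \<in> borel_measurable (lebesgue_on \<Omega>)"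
      "c \<in> borel_measurable (lebesgue_on \<Omega>)" "d \<in> borel_measurable (lebesgue_on \<Omega>)"
      "h \<in> borel_measurable (lebesgue_on \<Omega>)"
    and K: "\<And>x \<xi>. x \<in> \<Omega> \<Longrightarrow> norm (A x *v \<xi>) \<le> K * norm \<xi>" "0 \<le> K"
    and h: "\<And>x. 1 \<le> h x" "\<And>x. (norm (b x))\<^sup>2 \<le> h x" "\<And>x. (norm (c x))\<^sup>2 \<le> h x" "\<And>x. \<bar>d x\<bar> \<le> h x"
    and C: "C < \<infinity>" "\<And>f D. C1_supported \<Omega> f D \<Longrightarrow>
      (\<integral>\<^sup>+x. ennreal (h x * (f x)\<^sup>2) \<partial>lebesgue_on \<Omega>) \<le> C * (\<integral>\<^sup>+x. ennreal ((norm (D x))\<^sup>2) \<partial>lebesgue_on \<Omega>)"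
begin

abbreviation "M \<equiv> lebesgue_on \<Omega>"

lemma h_nonneg: "0 \<le> h x" using h(1)[of x] by linarith

lemma energy_nonneg: "0 \<le> energy h u Du x" using h_nonneg[of x] by (simp add: energy_def)

lemma measurable_energy [measurable]:
  fixes u :: "real^'n \<Rightarrow> real" and Du :: "real^'n \<Rightarrow> real^'n"
  assumes [measurable]: "u \<in> borel_measurable M" "Du \<in> borel_measurable M"
  shows "energy h u Du \<in> borel_measurable M"
  unfolding energy_def[abs_def] using meas(5) by measurable

lemma W12_0_measurable:
  assumes "W12_0 \<Omega> u Du" shows "u \<in> borel_measurable M" "Du \<in> borel_measurable M"
  using assms unfolding W12_0_def W12_def Lp_on_def by auto

lemma W12_0_energy_approx:
  assumes W: "W12_0 \<Omega> u Du"
  obtains \<phi> where "\<And>k. test_function \<Omega> (\<phi> k)"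
    "(\<lambda>k. \<integral>\<^sup>+x. (ennreal (energy h (\<lambda>x. \<phi> k x - u x) (\<lambda>x. grad (\<phi> k) x - Du x) x))\<^sup>2 \<partial>M) \<longlonglongrightarrow> 0"
proof -
  obtain \<phi> where \<phi>: "\<And>k. test_function \<Omega> (\<phi> k)"
    and lim: "(\<lambda>k. \<integral>\<^sup>+x. ennreal ((\<phi> k x - u x)\<^sup>2) \<partial>M) \<longlonglongrightarrow> 0"
      "(\<lambda>k. \<integral>\<^sup>+x. ennreal ((norm (grad (\<phi> k) x - Du x))\<^sup>2) \<partial>M) \<longlonglongrightarrow> 0"
    using W12_0_approx[OF W \<Omega>] by blast
  note \<phi>C = test_function_C1_supported[OF \<phi>]
  note [measurable] = C1_supported_measurable(3,4)[OF \<phi>C] W12_0_measurable[OF W] meas(5)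
  have lim_h: "(\<lambda>k. \<integral>\<^sup>+x. ennreal (h x * (\<phi> k x - u x)\<^sup>2) \<partial>M) \<longlonglongrightarrow> 0"
    by (rule weighted_L2_tendsto[OF C meas(5) h_nonneg \<phi>C _ _ lim]) (auto intro: W12_0_measurable[OF W])
  have "(\<lambda>k. 2 * (\<integral>\<^sup>+x. ennreal ((norm (grad (\<phi> k) x - Du x))\<^sup>2) \<partial>M) + 2 * (\<integral>\<^sup>+x. ennreal (h x * (\<phi> k x - u x)\<^sup>2) \<partial>M))
      \<longlonglongrightarrow> 2 * 0 + 2 * 0"
    by (intro tendsto_add ennreal_tendsto_cmult lim lim_h) auto
  then have lim2: "(\<lambda>k. 2 * (\<integral>\<^sup>+x. ennreal ((norm (grad (\<phi> k) x - Du x))\<^sup>2) \<partial>M) + 2 * (\<integral>\<^sup>+x. ennreal (h x * (\<phi> k x - u x)\<^sup>2) \<partial>M))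
      \<longlonglongrightarrow> 0" by simp
  show ?thesis
  proof (rule that[of \<phi>])
    show "(\<lambda>k. \<integral>\<^sup>+x. (ennreal (energy h (\<lambda>x. \<phi> k x - u x) (\<lambda>x. grad (\<phi> k) x - Du x) x))\<^sup>2 \<partial>M) \<longlonglongrightarrow> 0"
      by (rule tendsto_sandwich[OF _ _ tendsto_const lim2])
        (auto intro!: always_eventually nn_integral_energy_squared_le h_nonneg)
  qed (rule \<phi>)
qed

lemma test_function_energy_finite:
  assumes "test_function \<Omega> \<phi>"
  shows "(\<integral>\<^sup>+x. (ennreal (energy h \<phi> (grad \<phi>) x))\<^sup>2 \<partial>M) < \<infinity>"
proof -
  note \<phi>C = test_function_C1_supported[OF assms]
  note [measurable] = C1_supported_measurable(3,4)[OF \<phi>C] meas(5)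
  note sq = C1_supported_square_integrable(2)[OF \<phi>C \<Omega>(2,1)]
  have "(\<integral>\<^sup>+x. ennreal (h x * (\<phi> x)\<^sup>2) \<partial>M) < \<infinity>"
    using C(2)[OF \<phi>C] sq C(1) by (auto simp: ennreal_mult_less_top elim!: le_less_trans)
  then show ?thesis
    using nn_integral_energy_squared_le[of h M \<phi> "grad \<phi>"] sq h_nonneg
    by (auto simp: ennreal_mult_less_top elim!: le_less_trans)
qed

text \<open>Some \<open>\<phi> k\<close> is at finite energy distance from \<open>u\<close> and has finite energy itself; this
  transfers the integrability of \<open>h * u\<^sup>2\<close>, a consequence of the Sobolev inequality, to the limit \<open>u\<close>.\<close>

lemma W12_0_energy_finite:
  assumes W: "W12_0 \<Omega> u Du"
  shows "(\<integral>\<^sup>+x. (ennreal (energy h u Du x))\<^sup>2 \<partial>M) < \<infinity>"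
proof -
  obtain \<phi> where \<phi>: "\<And>k. test_function \<Omega> (\<phi> k)"
    and lim: "(\<lambda>k. \<integral>\<^sup>+x. (ennreal (energy h (\<lambda>x. \<phi> k x - u x) (\<lambda>x. grad (\<phi> k) x - Du x) x))\<^sup>2 \<partial>M) \<longlonglongrightarrow> 0"
    using W12_0_energy_approx[OF W] by blast
  obtain k where k: "(\<integral>\<^sup>+x. (ennreal (energy h (\<lambda>x. \<phi> k x - u x) (\<lambda>x. grad (\<phi> k) x - Du x) x))\<^sup>2 \<partial>M) < 1"
    using eventually_happens[OF order_tendstoD(2)[OF lim, of 1]] by auto
  note [measurable] = C1_supported_measurable(3,4)[OF test_function_C1_supported[OF \<phi>]] W12_0_measurable[OF W]
  let ?e = "energy h (\<phi> k) (grad (\<phi> k))" and ?z = "energy h (\<lambda>x. \<phi> k x - u x) (\<lambda>x. grad (\<phi> k) x - Du x)"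
  have "(\<integral>\<^sup>+x. (ennreal (energy h u Du x))\<^sup>2 \<partial>M) \<le> (\<integral>\<^sup>+x. ennreal (1 * (norm (?e x - (- ?z x)))\<^sup>2) \<partial>M)"
  proof (intro nn_integral_mono)
    fix x
    have "norm (Du x) \<le> norm (grad (\<phi> k) x) + norm (grad (\<phi> k) x - Du x)"
      using norm_triangle_ineq4[of "grad (\<phi> k) x" "grad (\<phi> k) x - Du x"] by simp
    moreover have "sqrt (h x) * \<bar>u x\<bar> \<le> sqrt (h x) * (\<bar>\<phi> k x\<bar> + \<bar>\<phi> k x - u x\<bar>)"
      using h_nonneg by (intro mult_left_mono) auto
    ultimately have "energy h u Du x \<le> ?e x + ?z x" by (simp add: energy_def algebra_simps)
    then have "(energy h u Du x)\<^sup>2 \<le> (?e x + ?z x)\<^sup>2"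
      by (intro power_mono energy_nonneg h_nonneg)
    then show "(ennreal (energy h u Du x))\<^sup>2 \<le> ennreal (1 * (norm (?e x - (- ?z x)))\<^sup>2)"
      by (subst ennreal_power) (auto intro: energy_nonneg h_nonneg ennreal_leI)
  qed
  also have "\<dots> \<le> 2 * (\<integral>\<^sup>+x. ennreal (1 * (norm (?e x))\<^sup>2) \<partial>M) + 2 * (\<integral>\<^sup>+x. ennreal (1 * (norm (- ?z x))\<^sup>2) \<partial>M)"
    by (rule nn_integral_norm_diff_squared_le) auto
  also have "\<dots> = 2 * (\<integral>\<^sup>+x. (ennreal (?e x))\<^sup>2 \<partial>M) + 2 * (\<integral>\<^sup>+x. (ennreal (?z x))\<^sup>2 \<partial>M)"
    by (simp add: ennreal_power energy_nonneg h_nonneg)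
  also have "\<dots> < \<infinity>"
    using test_function_energy_finite[OF \<phi>[of k]] k by (auto simp: ennreal_mult_less_top intro: less_trans)
  finally show ?thesis .
qed

lemma form_tendsto:
  assumes v: "W12_0 \<Omega> v Dv" and u: "W12_0 \<Omega> u Du" and \<phi>: "\<And>k. test_function \<Omega> (\<phi> k)"
    and lim: "(\<lambda>k. \<integral>\<^sup>+x. (ennreal (energy h (\<lambda>x. \<phi> k x - u x) (\<lambda>x. grad (\<phi> k) x - Du x) x))\<^sup>2 \<partial>M) \<longlonglongrightarrow> 0"
  shows "(\<lambda>k. LINT x|M. form_density A b c d v Dv (\<phi> k) (grad (\<phi> k)) x)
    \<longlonglongrightarrow> (LINT x|M. form_density A b c d v Dv u Du x)"
proof -
  note [measurable] = C1_supported_measurable(3,4)[OF test_function_C1_supported[OF \<phi>]]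
    W12_0_measurable[OF u] W12_0_measurable[OF v] meas
  have le: "\<bar>form_density A b c d v Dv w Dw x\<bar> \<le> (K + 1) * (energy h v Dv x * energy h w Dw x)"
    if "x \<in> \<Omega>" for w Dw x
    using that K h by (intro abs_form_density_le) auto
  note nn = energy_nonneg and fin = W12_0_energy_finite[OF v]
  have int: "integrable M (form_density A b c d v Dv w Dw)"
    if "(\<integral>\<^sup>+x. (ennreal (energy h w Dw x))\<^sup>2 \<partial>M) < \<infinity>"
      "w \<in> borel_measurable M" "Dw \<in> borel_measurable M" for w Dw
    using that K le
    by (intro integrable_of_energy_bound[where F = "energy h v Dv" and Z = "energy h w Dw" and K = "K + 1"]
        fin nn borel_measurable_form_density) auto
  show ?thesis
    using K le
    by (intro integral_tendsto_of_energy_bound[where F = "energy h v Dv" and K = "K + 1", OF _ _ _ _ fin lim]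
        int W12_0_energy_finite[OF u] test_function_energy_finite[OF \<phi>] nn)
      (auto simp: form_density_diff[symmetric])
qed

lemma source_tendsto:
  assumes u: "W12_0 \<Omega> u Du" and \<phi>: "\<And>k. test_function \<Omega> (\<phi> k)" and f: "Linf_on \<Omega> f"
    and lim: "(\<lambda>k. \<integral>\<^sup>+x. (ennreal (energy h (\<lambda>x. \<phi> k x - u x) (\<lambda>x. grad (\<phi> k) x - Du x) x))\<^sup>2 \<partial>M) \<longlonglongrightarrow> 0"
  shows "(\<lambda>k. LINT x|M. f x * \<phi> k x) \<longlonglongrightarrow> (LINT x|M. f x * u x)"
proof -
  note [measurable] = C1_supported_measurable(3,4)[OF test_function_C1_supported[OF \<phi>]]
    W12_0_measurable[OF u]
  have fm[measurable]: "f \<in> borel_measurable M" using f by (simp add: Linf_on_def)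
  obtain B where B: "AE x in M. \<bar>f x\<bar> \<le> B" using f by (auto simp: Linf_on_def)
  have fin: "(\<integral>\<^sup>+x. (ennreal \<bar>f x\<bar>)\<^sup>2 \<partial>M) < \<infinity>"
  proof -
    have "(\<integral>\<^sup>+x. (ennreal \<bar>f x\<bar>)\<^sup>2 \<partial>M) \<le> (\<integral>\<^sup>+x. (ennreal B)\<^sup>2 \<partial>M)"
      by (intro nn_integral_mono_AE, use B in eventually_elim) (auto intro!: power_mono ennreal_leI)
    also have "\<dots> = (ennreal B)\<^sup>2 * emeasure lebesgue \<Omega>"
      using \<Omega> by (simp add: emeasure_restrict_space)
    also have "\<dots> < \<infinity>" using \<Omega> by (auto simp: ennreal_mult_less_top power_less_top_ennreal)
    finally show ?thesis .
  qed
  have le: "\<bar>f x * w x\<bar> \<le> 1 * (\<bar>f x\<bar> * energy h w Dw x)" for w Dw x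
  proof -
    have "\<bar>w x\<bar> \<le> sqrt (h x) * \<bar>w x\<bar>" using h(1)[of x] by (simp add: mult_le_cancel_right1)
    then show ?thesis by (auto simp: abs_mult energy_def intro!: mult_left_mono add_increasing)
  qed
  note nn = energy_nonneg
  have int: "integrable M (\<lambda>x. f x * w x)"
    if "(\<integral>\<^sup>+x. (ennreal (energy h w Dw x))\<^sup>2 \<partial>M) < \<infinity>"
      "w \<in> borel_measurable M" "Dw \<in> borel_measurable M" for w and Dw :: "real^'n \<Rightarrow> real^'n"
    using that le[of _ w Dw]
    by (intro integrable_of_energy_bound[where F = "\<lambda>x. \<bar>f x\<bar>" and Z = "energy h w Dw" and K = 1] fin nn) (auto intro: measurable_energy)
  have "f x * \<phi> k x - f x * u x = f x * (\<phi> k x - u x)" for k x by (simp add: algebra_simps)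
  then show ?thesis
    using le
    by (intro integral_tendsto_of_energy_bound[where F = "\<lambda>x. \<bar>f x\<bar>" and K = 1, OF _ _ _ _ fin lim]
        int[OF W12_0_energy_finite[OF u]] int[OF test_function_energy_finite[OF \<phi>]] nn) auto
qed

text \<open>Both sides of the weak equation are continuous in the test function for the energy distance.\<close>

lemma weak_solution_test_W12_0:
  assumes v: "W12_0 \<Omega> v Dv" and f: "Linf_on \<Omega> f"
    and sol: "\<And>\<psi>. test_function \<Omega> \<psi> \<Longrightarrow> (LINT x|M. form_density A b c d v Dv \<psi> (grad \<psi>) x) = (LINT x|M. f x * \<psi> x)"
    and u: "W12_0 \<Omega> u Du"
  shows "(LINT x|M. form_density A b c d v Dv u Du x) = (LINT x|M. f x * u x)"
proof -
  obtain \<phi> where \<phi>: "\<And>k. test_function \<Omega> (\<phi> k)"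
    and lim: "(\<lambda>k. \<integral>\<^sup>+x. (ennreal (energy h (\<lambda>x. \<phi> k x - u x) (\<lambda>x. grad (\<phi> k) x - Du x) x))\<^sup>2 \<partial>M) \<longlonglongrightarrow> 0"
    using W12_0_energy_approx[OF u] by blast
  show ?thesis
    using form_tendsto[OF v u \<phi> lim] source_tendsto[OF u \<phi> f lim] sol[OF \<phi>]
    by (simp add: LIMSEQ_unique)
qed

end

section \<open>Kernels determined by their integrals over rectangles\<close>

text \<open>Rectangles generate the product sigma-algebra and are closed under intersections, and the sets over
  which \<open>f\<close> and \<open>g\<close> have the same integral form a Dynkin system.\<close>

lemma AE_eq_of_rectangle_integrals_eq:
  fixes f g :: "'a \<times> 'b \<Rightarrow> real"
  assumes f: "integrable (M1 \<Otimes>\<^sub>M M2) f" and g: "integrable (M1 \<Otimes>\<^sub>M M2) g"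
    and eq: "\<And>E F. E \<in> sets M1 \<Longrightarrow> F \<in> sets M2 \<Longrightarrow>
      (LINT z:E \<times> F|M1 \<Otimes>\<^sub>M M2. f z) = (LINT z:E \<times> F|M1 \<Otimes>\<^sub>M M2. g z)"
  shows "AE z in M1 \<Otimes>\<^sub>M M2. f z = g z"
proof (rule density_unique_real[OF f g])
  let ?P = "M1 \<Otimes>\<^sub>M M2" and ?R = "{a \<times> b | a b. a \<in> sets M1 \<and> b \<in> sets M2}"
  have si: "set_integrable ?P A h" if "A \<in> sets ?P" "integrable ?P h" for A and h :: "'a \<times> 'b \<Rightarrow> real"
    unfolding set_integrable_def using that by (rule integrable_mult_indicator)
  fix A assume "A \<in> sets ?P"
  then have "A \<in> sigma_sets (space M1 \<times> space M2) ?R" by (simp add: sets_pair_measure)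
  with Int_stable_pair_measure_generator pair_measure_closed
  show "(LINT z:A|?P. f z) = (LINT z:A|?P. g z)"
  proof (induction rule: sigma_sets_induct_disjoint)
    case (basic A)
    then show ?case using eq by auto
  next
    case empty
    show ?case by (simp add: set_lebesgue_integral_def)
  next
    case (compl A)
    have A: "A \<in> sets ?P" using compl(1) by (simp add: sets_pair_measure)
    let ?S = "space M1 \<times> space M2"
    have S: "?S \<in> sets ?P" by simp
    have split: "(LINT z:?S - A|?P. h z) = (LINT z:?S|?P. h z) - (LINT z:A|?P. h z)" if "integrable ?P h" for h :: "'a \<times> 'b \<Rightarrow> real"
    proof -
      have "A \<subseteq> ?S" using sets.sets_into_space[OF A] by (simp add: space_pair_measure)
      then have "(LINT z:?S|?P. h z) = (LINT z:A \<union> (?S - A)|?P. h z)" by (simp add: Un_absorb1)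
      also have "\<dots> = (LINT z:A|?P. h z) + (LINT z:?S - A|?P. h z)"
        using A S that by (intro set_integral_Un si sets.Diff) auto
      finally show ?thesis by simp
    qed
    show ?case using compl(2) eq[of "space M1" "space M2"] by (simp add: split f g)
  next
    case (union A)
    have A: "A i \<in> sets ?P" for i using union(2) by (auto simp: sets_pair_measure)
    have "(LINT z:(\<Union>i. A i)|?P. h z) = (\<Sum>i. LINT z:A i|?P. h z)" if "integrable ?P h" for h :: "'a \<times> 'b \<Rightarrow> real"
      using A union(1) that
      by (intro lebesgue_integral_countable_add si sets.countable_UN) (auto simp: disjoint_family_on_def)
    then show ?case using f g union(3) by simp
  qed
qed

context pair_sigma_finite
begin

text \<open>The two iterated integrals use opposite orders, and neither \<open>G\<close> nor \<open>H\<close> need be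
  integrable over \<open>S \<times> T\<close>: only the slices are. The sets \<open>X k\<close> and \<open>Y k\<close> of points whose slices
  have norm at most \<open>k\<close> remedy this. The bound on \<open>Y k\<close> makes \<open>G\<close> integrable over
  \<open>X k \<times> Y k\<close>, the bound on \<open>X k\<close> does so for \<open>H\<close>, Fubini's theorem turns the hypothesis into
  equality of integrals over rectangles there, and these products exhaust almost all of \<open>S \<times> T\<close>.\<close>

lemma kernel_AE_eq:
  fixes G H :: "'a \<times> 'b \<Rightarrow> real"
  assumes [measurable]: "G \<in> borel_measurable (M1 \<Otimes>\<^sub>M M2)" "H \<in> borel_measurable (M1 \<Otimes>\<^sub>M M2)"
    and intG: "AE y in M2. integrable M1 (\<lambda>x. G (x, y))"
    and intH: "AE x in M1. integrable M2 (\<lambda>y. H (x, y))"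
    and S[measurable]: "S \<in> sets M1" "emeasure M1 S < \<infinity>" and T[measurable]: "T \<in> sets M2" "emeasure M2 T < \<infinity>"
    and eq: "\<And>E F. E \<in> sets M1 \<Longrightarrow> E \<subseteq> S \<Longrightarrow> F \<in> sets M2 \<Longrightarrow> F \<subseteq> T \<Longrightarrow>
      (LINT y|M2. indicator F y * (LINT x|M1. G (x, y) * indicator E x))
      = (LINT x|M1. indicator E x * (LINT y|M2. H (x, y) * indicator F y))"
  shows "AE z in M1 \<Otimes>\<^sub>M M2. z \<in> S \<times> T \<longrightarrow> G z = H z"
proof -
  let ?P = "M1 \<Otimes>\<^sub>M M2"
  define p where "p x = (\<integral>\<^sup>+y. ennreal \<bar>H (x, y)\<bar> \<partial>M2)" for x
  define q where "q y = (\<integral>\<^sup>+x. ennreal \<bar>G (x, y)\<bar> \<partial>M1)" for y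
  have [measurable]: "p \<in> borel_measurable M1" "q \<in> borel_measurable M2"
    unfolding p_def q_def by measurable
  define X where "X k = {x \<in> space M1. x \<in> S \<and> p x \<le> of_nat k}" for k :: nat
  define Y where "Y k = {y \<in> space M2. y \<in> T \<and> q y \<le> of_nat k}" for k :: nat
  have X[measurable]: "X k \<in> sets M1" and Y[measurable]: "Y k \<in> sets M2" for k
    unfolding X_def Y_def by measurable
  have XS: "X k \<subseteq> S" and YT: "Y k \<subseteq> T" for k by (auto simp: X_def Y_def)
  define G' where "G' k z = indicator (X k \<times> Y k) z * G z" for k z
  define H' where "H' k z = indicator (X k \<times> Y k) z * H z" for k z
  have [measurable]: "G' k \<in> borel_measurable ?P" "H' k \<in> borel_measurable ?P" for k
    unfolding G'_def H'_def by measurable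
  have iG: "integrable ?P (G' k)" for k
  proof (rule integrableI_bounded)
    have "(\<integral>\<^sup>+z. norm (G' k z) \<partial>?P) = (\<integral>\<^sup>+y. \<integral>\<^sup>+x. norm (G' k (x, y)) \<partial>M1 \<partial>M2)"
      by (rule nn_integral_snd[symmetric]) measurable
    also have "\<dots> \<le> (\<integral>\<^sup>+y. of_nat k * indicator T y \<partial>M2)"
    proof (intro nn_integral_mono)
      fix y assume "y \<in> space M2"
      show "(\<integral>\<^sup>+x. norm (G' k (x, y)) \<partial>M1) \<le> of_nat k * indicator T y"
      proof (cases "y \<in> Y k")
        case True
        have "(\<integral>\<^sup>+x. norm (G' k (x, y)) \<partial>M1) \<le> q y"
          unfolding q_def by (intro nn_integral_mono) (auto simp: G'_def indicator_def)
        also have "\<dots> \<le> of_nat k * indicator T y" using True by (auto simp: Y_def)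
        finally show ?thesis .
      qed (simp add: G'_def)
    qed
    also have "\<dots> < \<infinity>" using T by (simp add: nn_integral_cmult_indicator ennreal_mult_less_top of_nat_less_top)
    finally show "(\<integral>\<^sup>+z. norm (G' k z) \<partial>?P) < \<infinity>" .
  qed simp
  have iH: "integrable ?P (H' k)" for k
  proof (rule integrableI_bounded)
    have "(\<integral>\<^sup>+z. norm (H' k z) \<partial>?P) = (\<integral>\<^sup>+x. \<integral>\<^sup>+y. norm (H' k (x, y)) \<partial>M2 \<partial>M1)"
      by (rule M2.nn_integral_fst[symmetric]) measurable
    also have "\<dots> \<le> (\<integral>\<^sup>+x. of_nat k * indicator S x \<partial>M1)"
    proof (intro nn_integral_mono)
      fix x assume "x \<in> space M1"
      show "(\<integral>\<^sup>+y. norm (H' k (x, y)) \<partial>M2) \<le> of_nat k * indicator S x"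
      proof (cases "x \<in> X k")
        case True
        have "(\<integral>\<^sup>+y. norm (H' k (x, y)) \<partial>M2) \<le> p x"
          unfolding p_def by (intro nn_integral_mono) (auto simp: H'_def indicator_def)
        also have "\<dots> \<le> of_nat k * indicator S x" using True by (auto simp: X_def)
        finally show ?thesis .
      qed (simp add: H'_def)
    qed
    also have "\<dots> < \<infinity>" using S by (simp add: nn_integral_cmult_indicator ennreal_mult_less_top of_nat_less_top)
    finally show "(\<integral>\<^sup>+z. norm (H' k z) \<partial>?P) < \<infinity>" .
  qed simp
  have local: "AE z in ?P. G' k z = H' k z" for k
  proof (rule AE_eq_of_rectangle_integrals_eq[OF iG iH])
    fix E F assume [measurable]: "E \<in> sets M1" "F \<in> sets M2"
    have "integrable ?P (\<lambda>z. indicator (E \<times> F) z *\<^sub>R G' k z)"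
      by (intro integrable_mult_indicator iG) measurable
    then have "(LINT z:E \<times> F|?P. G' k z) = (LINT y|M2. LINT x|M1. indicator (E \<times> F) (x, y) *\<^sub>R G' k (x, y))"
      unfolding set_lebesgue_integral_def by (subst integral_snd) (auto simp: case_prod_beta')
    also have "\<dots> = (LINT y|M2. LINT x|M1. indicator (F \<inter> Y k) y * (G (x, y) * indicator (E \<inter> X k) x))"
      by (intro Bochner_Integration.integral_cong) (auto simp: G'_def indicator_def)
    also have "\<dots> = (LINT y|M2. indicator (F \<inter> Y k) y * (LINT x|M1. G (x, y) * indicator (E \<inter> X k) x))"
      by simp
    also have "\<dots> = (LINT x|M1. indicator (E \<inter> X k) x * (LINT y|M2. H (x, y) * indicator (F \<inter> Y k) y))"
      using XS YT by (intro eq) auto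
    also have "\<dots> = (LINT x|M1. LINT y|M2. indicator (E \<inter> X k) x * (H (x, y) * indicator (F \<inter> Y k) y))"
      by simp
    also have "\<dots> = (LINT x|M1. LINT y|M2. indicator (E \<times> F) (x, y) *\<^sub>R H' k (x, y))"
      by (intro Bochner_Integration.integral_cong) (auto simp: H'_def indicator_def)
    also have "\<dots> = (LINT z:E \<times> F|?P. H' k z)"
    proof -
      have "integrable ?P (\<lambda>z. indicator (E \<times> F) z *\<^sub>R H' k z)"
        by (intro integrable_mult_indicator iH) measurable
      then show ?thesis
        unfolding set_lebesgue_integral_def by (subst integral_fst) (auto simp: case_prod_beta')
    qed
    finally show "(LINT z:E \<times> F|?P. G' k z) = (LINT z:E \<times> F|?P. H' k z)" .
  qed
  have fin: "AE z in ?P. p (fst z) < \<infinity> \<and> q (snd z) < \<infinity>"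
  proof (rule AE_pair_measure)
    have p: "AE x in M1. p x < \<infinity>" using intH by eventually_elim (auto simp: p_def integrable_iff_bounded)
    have q: "AE y in M2. q y < \<infinity>" using intG by eventually_elim (auto simp: q_def integrable_iff_bounded)
    show "AE x in M1. AE y in M2. p (fst (x, y)) < \<infinity> \<and> q (snd (x, y)) < \<infinity>"
      using p by eventually_elim (use q in auto)
  qed measurable
  have "AE z in ?P. \<forall>k. G' k z = H' k z" using local by (simp add: AE_all_countable)
  then show ?thesis
    using fin AE_space
  proof eventually_elim
    case (elim z)
    show ?case
    proof
      assume z: "z \<in> S \<times> T"
      obtain k l :: nat where "p (fst z) < of_nat k" "q (snd z) < of_nat l"
        using elim(2) ennreal_Ex_less_of_nat by (metis infinity_ennreal_def)
      then have "p (fst z) \<le> of_nat (max k l)" "q (snd z) \<le> of_nat (max k l)"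
        by (meson less_imp_le of_nat_mono order_trans max.cobounded1 max.cobounded2)+
      then have "z \<in> X (max k l) \<times> Y (max k l)"
        using z elim(3) by (auto simp: X_def Y_def space_pair_measure)
      then show "G z = H z" using elim(1)[rule_format, of "max k l"] by (simp add: G'_def H'_def)
    qed
  qed
qed

end

lemma AE_lborel_swap:
  assumes "AE z in (lborel :: ('a::euclidean_space \<times> 'b::euclidean_space) measure). P z"
  shows "AE z in (lborel :: ('b \<times> 'a) measure). P (snd z, fst z)"
proof -
  have "AE z in (lborel \<Otimes>\<^sub>M lborel :: ('a \<times> 'b) measure). P z"
    unfolding lborel_prod by (rule assms)
  then have "AE z in distr (lborel \<Otimes>\<^sub>M lborel :: ('b \<times> 'a) measure) (lborel \<Otimes>\<^sub>M lborel) (\<lambda>(x, y). (y, x)). P z"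
    by (subst (asm) lborel_pair.distr_pair_swap)
  then have "AE z in (lborel \<Otimes>\<^sub>M lborel :: ('b \<times> 'a) measure). P (case z of (x, y) \<Rightarrow> (y, x))"
    by (rule AE_distrD[rotated]) measurable
  then show ?thesis unfolding lborel_prod case_prod_beta' .
qed

text \<open>A kernel measurable for the Lebesgue measure of the product is replaced by a Borel kernel. The two
  agree outside a null set of the product, hence on almost every slice almost everywhere, so
  slice integrals are the same; the exceptional \<open>y\<close> are independent of the set \<open>E\<close>.\<close>

lemma kernel_borel_representative:
  fixes G :: "'a::euclidean_space \<Rightarrow> 'b::euclidean_space \<Rightarrow> real"
  assumes S: "S \<in> sets borel" and T: "T \<in> sets borel"
    and G: "(\<lambda>(x, y). G x y) \<in> borel_measurable (lebesgue_on (S \<times> T))"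
    and int: "AE y in lebesgue_on T. integrable (lebesgue_on S) (\<lambda>x. G x y)"
  obtains G' where "G' \<in> borel_measurable borel"
    "AE z in lborel. z \<in> S \<times> T \<longrightarrow> G' z = G (fst z) (snd z)"
    "AE y in lborel. integrable lborel (\<lambda>x. G' (x, y))"
    "AE y in lborel. y \<in> T \<longrightarrow> (\<forall>E\<in>sets borel. (LINT x|lebesgue_on S. G x y * indicator E x) = (LINT x|lborel. G' (x, y) * indicator E x))"
proof -
  define G0 where "G0 z = (if z \<in> S \<times> T then case z of (x, y) \<Rightarrow> G x y else 0)" for z
  have "S \<times> T \<in> sets lebesgue" using borel_Times[OF S T] by auto
  from borel_measurable_if_I[OF G this] have "G0 \<in> borel_measurable lebesgue"
    unfolding G0_def[abs_def] .
  then obtain G' where G'[measurable]: "G' \<in> borel_measurable borel" and eq: "AE z in lborel. G0 z = G' z"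
    using completion_ex_borel_measurable_real[of G0 lborel] by auto
  have "AE z in (lborel \<Otimes>\<^sub>M lborel :: ('b \<times> 'a) measure). G0 (snd z, fst z) = G' (snd z, fst z)"
    unfolding lborel_prod by (rule AE_lborel_swap[OF eq])
  from lborel_pair.AE_pair[OF this] have eq2: "AE y in lborel. AE x in lborel. G0 (x, y) = G' (x, y)"
    by simp
  have S': "S \<inter> space lebesgue \<in> sets lebesgue" and T': "T \<inter> space lebesgue \<in> sets lebesgue"
    using S T by auto
  have int': "AE y in lborel. y \<in> T \<longrightarrow> integrable lebesgue (\<lambda>x. indicator S x *\<^sub>R G x y)"
    using int by (simp add: AE_restrict_space_iff[OF T'] AE_completion_iff integrable_restrict_space[OF S'])
  have Gm[measurable]: "(\<lambda>x. G' (x, y)) \<in> borel_measurable borel" for y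
    by (rule measurable_compose[OF _ G']) simp
  show ?thesis
  proof (rule that[OF G'])
    show "AE z in lborel. z \<in> S \<times> T \<longrightarrow> G' z = G (fst z) (snd z)"
      using eq by eventually_elim (auto simp: G0_def)
    show "AE y in lborel. integrable lborel (\<lambda>x. G' (x, y))"
      using eq2 int'
    proof eventually_elim
      case (elim y)
      show ?case
      proof (cases "y \<in> T")
        case True
        then have i: "integrable lebesgue (\<lambda>x. indicator S x *\<^sub>R G x y)" using elim by simp
        have "integrable lebesgue (\<lambda>x. G' (x, y))"
        proof (rule integrable_cong_AE_imp[OF i])
          show "AE x in lebesgue. indicator S x *\<^sub>R G x y = G' (x, y)"
            unfolding AE_completion_iff using elim(1) by eventually_elim (use True in \<open>auto simp: G0_def indicator_def split: if_splits\<close>)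
        qed (auto intro: measurable_completion)
        then show ?thesis by (simp add: integrable_completion)
      next
        case False
        have "AE x in lborel. 0 = G' (x, y)"
          using elim(1) by eventually_elim (use False in \<open>auto simp: G0_def\<close>)
        from integrable_cong_AE_imp[OF integrable_zero _ this] show ?thesis by simp
      qed
    qed
    show "AE y in lborel. y \<in> T \<longrightarrow> (\<forall>E\<in>sets borel. (LINT x|lebesgue_on S. G x y * indicator E x) = (LINT x|lborel. G' (x, y) * indicator E x))"
      using eq2 int'
    proof eventually_elim
      case (elim y)
      show ?case
      proof (intro impI ballI)
        fix E :: "'a set" assume y: "y \<in> T" and E[measurable]: "E \<in> sets borel"
        have i[measurable]: "(\<lambda>x. indicator S x *\<^sub>R G x y) \<in> borel_measurable lebesgue" using elim y by (auto dest: borel_measurable_integrable)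
        have E'[measurable]: "indicator E \<in> borel_measurable lebesgue" by (auto intro: measurable_completion)
        have "(LINT x|lebesgue_on S. G x y * indicator E x) = (LINT x|lebesgue. (indicator S x *\<^sub>R G x y) * indicator E x)"
          by (simp add: integral_restrict_space[OF S'] mult_ac)
        also have "\<dots> = (LINT x|lebesgue. G' (x, y) * indicator E x)"
        proof (rule integral_cong_AE)
          show "AE x in lebesgue. (indicator S x *\<^sub>R G x y) * indicator E x = G' (x, y) * indicator E x"
            unfolding AE_completion_iff using elim(1) by eventually_elim (use y in \<open>auto simp: G0_def indicator_def split: if_splits\<close>)
        qed (use i E' in \<open>auto intro!: borel_measurable_times intro: measurable_completion\<close>)
        also have "\<dots> = (LINT x|lborel. G' (x, y) * indicator E x)"
          by (intro integral_completion) measurable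
        finally show "(LINT x|lebesgue_on S. G x y * indicator E x) = (LINT x|lborel. G' (x, y) * indicator E x)" .
      qed
    qed
  qed
qed

section \<open>Symmetry of the Green functions\<close>

text \<open>Each solution is an admissible test function in the equation of the other. The two resulting
  left-hand sides coincide, because their integrands do.\<close>

lemma weak_solution_duality:
  assumes L: "drift_form \<Omega> A b c d h K C" and LT: "drift_form \<Omega> (\<lambda>x. transpose (A x)) c b d h K' C"
    and v: "weak_solution \<Omega> A b c d f v" and u: "weak_solution \<Omega> (\<lambda>x. transpose (A x)) c b d \<phi> u"
    and f: "Linf_on \<Omega> f" and \<phi>: "Linf_on \<Omega> \<phi>"
  shows "(LINT x|lebesgue_on \<Omega>. f x * u x) = (LINT x|lebesgue_on \<Omega>. \<phi> x * v x)"
proof -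
  interpret L: drift_form \<Omega> A b c d h K C by (rule L)
  interpret LT: drift_form \<Omega> "\<lambda>x. transpose (A x)" c b d h K' C by (rule LT)
  obtain Dv where Dv: "W12_0 \<Omega> v Dv"
    "\<And>\<psi>. test_function \<Omega> \<psi> \<Longrightarrow> (LINT x|lebesgue_on \<Omega>. form_density A b c d v Dv \<psi> (grad \<psi>) x) = (LINT x|lebesgue_on \<Omega>. f x * \<psi> x)"
    using v unfolding weak_solution_def form_density_def by blast
  obtain Du where Du: "W12_0 \<Omega> u Du"
    "\<And>\<psi>. test_function \<Omega> \<psi> \<Longrightarrow> (LINT x|lebesgue_on \<Omega>. form_density (\<lambda>x. transpose (A x)) c b d u Du \<psi> (grad \<psi>) x) = (LINT x|lebesgue_on \<Omega>. \<phi> x * \<psi> x)"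
    using u unfolding weak_solution_def form_density_def by blast
  show ?thesis
    using L.weak_solution_test_W12_0[OF Dv(1) f Dv(2) Du(1)]
      LT.weak_solution_test_W12_0[OF Du(1) \<phi> Du(2) Dv(1)]
    by (simp add: form_density_transpose)
qed

lemma powr_sum4_le:
  fixes w x y z p :: real
  assumes "0 \<le> w" "0 \<le> x" "0 \<le> y" "0 \<le> z" "0 \<le> p"
  shows "(w + x + y + z) powr p \<le> 4 powr p * (w powr p + x powr p + y powr p + z powr p)"
proof -
  define m where "m = max (max w x) (max y z)"
  have "(w + x + y + z) powr p \<le> (4 * m) powr p"
    using assms by (intro powr_mono2) (auto simp: m_def max_def)
  also have "\<dots> = 4 powr p * m powr p" using assms by (intro powr_mult)
  also have "m powr p \<le> w powr p + x powr p + y powr p + z powr p"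
    unfolding m_def max_def by (auto simp: add_nonneg_nonneg)
  finally show ?thesis by (auto simp: mult_left_mono)
qed

lemma majorant_powr_integrable:
  fixes b c :: "real^'n \<Rightarrow> real^'n"
  assumes \<Omega>: "\<Omega> \<in> sets lebesgue" "emeasure lebesgue \<Omega> < \<infinity>"
    and b: "Lp_on \<Omega> p b" and c: "Lp_on \<Omega> p c" and d: "Lp_on \<Omega> (p / 2) d" and p: "0 < p"
  shows "(\<integral>\<^sup>+x. ennreal ((1 + (norm (b x))\<^sup>2 + (norm (c x))\<^sup>2 + \<bar>d x\<bar>) powr (p / 2)) \<partial>lebesgue_on \<Omega>) < \<infinity>"
proof -
  let ?M = "lebesgue_on \<Omega>"
  have [measurable]: "b \<in> borel_measurable ?M" "c \<in> borel_measurable ?M" "d \<in> borel_measurable ?M"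
    using b c d by (auto simp: Lp_on_def)
  have fin: "(\<integral>\<^sup>+x. ennreal (norm (b x) powr p) \<partial>?M) < \<infinity>" "(\<integral>\<^sup>+x. ennreal (norm (c x) powr p) \<partial>?M) < \<infinity>"
    "(\<integral>\<^sup>+x. ennreal (\<bar>d x\<bar> powr (p / 2)) \<partial>?M) < \<infinity>"
    using b c d by (auto simp: Lp_on_def integrable_iff_bounded)
  have sq: "((norm v)\<^sup>2) powr (p / 2) = norm v powr p" for v :: "real^'n"
  proof -
    have eq: "(norm v)\<^sup>2 = norm v powr 2" by (cases "v = 0") (auto simp: powr_numeral)
    show ?thesis unfolding eq powr_powr by simp
  qed
  have "(\<integral>\<^sup>+x. ennreal ((1 + (norm (b x))\<^sup>2 + (norm (c x))\<^sup>2 + \<bar>d x\<bar>) powr (p / 2)) \<partial>?M)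
      \<le> (\<integral>\<^sup>+x. ennreal (4 powr (p / 2)) * (1 + ennreal (norm (b x) powr p) + ennreal (norm (c x) powr p) + ennreal (\<bar>d x\<bar> powr (p / 2))) \<partial>?M)"
  proof (intro nn_integral_mono)
    fix x
    have "(1 + (norm (b x))\<^sup>2 + (norm (c x))\<^sup>2 + \<bar>d x\<bar>) powr (p / 2)
        \<le> 4 powr (p / 2) * (1 + norm (b x) powr p + norm (c x) powr p + \<bar>d x\<bar> powr (p / 2))"
      using powr_sum4_le[of 1 "(norm (b x))\<^sup>2" "(norm (c x))\<^sup>2" "\<bar>d x\<bar>" "p / 2"] p by (simp add: sq)
    from ennreal_leI[OF this]
    show "ennreal ((1 + (norm (b x))\<^sup>2 + (norm (c x))\<^sup>2 + \<bar>d x\<bar>) powr (p / 2))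
        \<le> ennreal (4 powr (p / 2)) * (1 + ennreal (norm (b x) powr p) + ennreal (norm (c x) powr p) + ennreal (\<bar>d x\<bar> powr (p / 2)))"
      by (simp add: ennreal_mult ennreal_plus)
  qed
  also have "\<dots> = ennreal (4 powr (p / 2)) * (emeasure lebesgue \<Omega> + (\<integral>\<^sup>+x. ennreal (norm (b x) powr p) \<partial>?M)
      + (\<integral>\<^sup>+x. ennreal (norm (c x) powr p) \<partial>?M) + (\<integral>\<^sup>+x. ennreal (\<bar>d x\<bar> powr (p / 2)) \<partial>?M))"
    using \<Omega> by (simp add: nn_integral_cmult nn_integral_add emeasure_restrict_space)
  also have "\<dots> < \<infinity>" using fin \<Omega> by (simp add: ennreal_mult_less_top)
  finally show ?thesis .
qed

lemma norm_matrix_vector_mult_le: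
  fixes A :: "real^'n^'m"
  assumes "\<And>i j. \<bar>A $ i $ j\<bar> \<le> B"
  shows "norm (A *v \<xi>) \<le> (real CARD('m) * real CARD('n) * B) * norm \<xi>"
proof -
  have "norm (A *v \<xi>) \<le> onorm ((*v) A) * norm \<xi>" by (intro onorm matrix_vector_mul_bounded_linear)
  also have "\<dots> \<le> (real CARD('m) * real CARD('n) * B) * norm \<xi>"
    by (intro mult_right_mono onorm_le_matrix_component assms) auto
  finally show ?thesis .
qed

lemma borel_measurable_transpose:
  fixes A :: "'a \<Rightarrow> real^'n^'m"
  assumes "A \<in> borel_measurable M" shows "(\<lambda>x. transpose (A x)) \<in> borel_measurable M"
proof -
  have "continuous_on UNIV (\<lambda>B :: real^'n^'m. transpose B)"
    unfolding transpose_def by (intro continuous_on_vec_lambda continuous_intros)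
  from measurable_compose[OF assms borel_measurable_continuous_onI[OF this]] show ?thesis .
qed

text \<open>The exponents \<open>n\<close> for \<open>b\<close>, \<open>c\<close> and \<open>n / 2\<close> for \<open>d\<close> put the weight \<open>1 + (norm b)\<^sup>2 + (norm c)\<^sup>2 + \<bar>d\<bar>\<close>
  in \<open>L\<^sup>n\<^sup>/\<^sup>2\<close>; the summand 1 is admissible because \<open>\<Omega>\<close> has finite measure.\<close>

lemma drift_form_of_coefficients:
  fixes \<Omega> :: "(real^'n) set"
  assumes n: "3 \<le> CARD('n)" and \<Omega>: "open \<Omega>" "emeasure lebesgue \<Omega> < \<infinity>"
    and A: "A \<in> borel_measurable (lebesgue_on \<Omega>)" "bounded (A ` \<Omega>)"
    and b: "Lp_on \<Omega> (real CARD('n)) b" and c: "Lp_on \<Omega> (real CARD('n)) c" and d: "Lp_on \<Omega> (real CARD('n) / 2) d"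
  obtains h K C where "drift_form \<Omega> A b c d h K C" "drift_form \<Omega> (\<lambda>x. transpose (A x)) c b d h K C"
proof -
  let ?M = "lebesgue_on \<Omega>"
  \<comment> \<open>symmetric in \<open>b\<close> and \<open>c\<close>, hence a weight for the transpose too\<close>
  define h where "h x = 1 + (norm (b x))\<^sup>2 + (norm (c x))\<^sup>2 + \<bar>d x\<bar>" for x
  have \<Omega>': "\<Omega> \<in> sets lebesgue" using \<Omega>(1) by simp
  have m[measurable]: "b \<in> borel_measurable ?M" "c \<in> borel_measurable ?M" "d \<in> borel_measurable ?M"
    using b c d by (auto simp: Lp_on_def)
  have hm: "h \<in> borel_measurable ?M" unfolding h_def by measurable
  have h0: "0 \<le> h x" for x by (simp add: h_def)
  have hp: "(\<integral>\<^sup>+x. ennreal (h x powr (DIM(real^'n) / 2)) \<partial>?M) < \<infinity>"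
    unfolding h_def using majorant_powr_integrable[OF \<Omega>' \<Omega>(2) b c d] n by simp
  obtain C where C: "C < \<infinity>" "\<And>f D. C1_supported \<Omega> f D \<Longrightarrow>
    (\<integral>\<^sup>+x. ennreal (h x * (f x)\<^sup>2) \<partial>?M) \<le> C * (\<integral>\<^sup>+x. ennreal ((norm (D x))\<^sup>2) \<partial>?M)"
    using weighted_sobolev_C1[OF _ \<Omega>' hm h0 hp] n by auto
  obtain B where B: "\<And>x. x \<in> \<Omega> \<Longrightarrow> norm (A x) \<le> B" "0 \<le> B"
    using A(2) unfolding bounded_pos by (auto intro: less_imp_le)
  have AB: "\<bar>A x $ i $ j\<bar> \<le> B" if "x \<in> \<Omega>" for x i j
  proof -
    have "\<bar>A x $ i $ j\<bar> \<le> norm (A x $ i)" by (rule component_le_norm_cart)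
    also have "\<dots> \<le> norm (A x)" by (rule Finite_Cartesian_Product.norm_nth_le)
    also have "\<dots> \<le> B" by (rule B(1)[OF that])
    finally show ?thesis .
  qed
  define K where "K = real CARD('n) * real CARD('n) * B"
  have K: "norm (A x *v \<xi>) \<le> K * norm \<xi>" "norm (transpose (A x) *v \<xi>) \<le> K * norm \<xi>" if "x \<in> \<Omega>" for x \<xi>
    using AB[OF that] unfolding K_def by (intro norm_matrix_vector_mult_le; simp add: transpose_def)+
  have hb: "1 \<le> h x" "(norm (b x))\<^sup>2 \<le> h x" "(norm (c x))\<^sup>2 \<le> h x" "\<bar>d x\<bar> \<le> h x" for x
    by (auto simp: h_def intro: add_nonneg_nonneg)
  have K0: "0 \<le> K" using B(2) by (simp add: K_def)
  show ?thesis
  proof (rule that)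
    show "drift_form \<Omega> A b c d h K C"
      by unfold_locales (use \<Omega>' \<Omega>(2) A(1) m hm K K0 hb C in auto)
    show "drift_form \<Omega> (\<lambda>x. transpose (A x)) c b d h K C"
      by unfold_locales (use \<Omega>' \<Omega>(2) borel_measurable_transpose[OF A(1)] m hm K K0 hb C in auto)
  qed
qed

lemma Linf_on_indicator:
  assumes "E \<in> sets borel" shows "Linf_on \<Omega> (indicator E)"
  unfolding Linf_on_def using assms
  by (auto intro!: measurable_restrict_space1 measurable_completion exI[of _ 1] simp: indicator_def)

lemma integral_lebesgue_on_indicator_AE:
  fixes u a :: "'a::euclidean_space \<Rightarrow> real"
  assumes \<Omega>: "\<Omega> \<in> sets borel" and F[measurable]: "F \<in> sets borel" "F \<subseteq> \<Omega>"
    and u: "u \<in> borel_measurable (lebesgue_on \<Omega>)" and a[measurable]: "a \<in> borel_measurable borel"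
    and eq: "AE y in lebesgue_on \<Omega>. u y = a y"
  shows "(LINT y|lebesgue_on \<Omega>. indicator F y * u y) = (LINT y|lborel. indicator F y * a y)"
proof -
  have \<Omega>': "\<Omega> \<inter> space lebesgue \<in> sets lebesgue" using \<Omega> by auto
  have am: "a \<in> borel_measurable (lebesgue_on \<Omega>)" "(indicator F :: 'a \<Rightarrow> real) \<in> borel_measurable (lebesgue_on \<Omega>)"
    by (auto intro!: measurable_restrict_space1 measurable_completion)
  have "(LINT y|lebesgue_on \<Omega>. indicator F y * u y) = (LINT y|lebesgue_on \<Omega>. indicator F y * a y)"
    using u am eq by (intro integral_cong_AE) (auto elim!: eventually_mono)
  also have "\<dots> = (LINT y|lebesgue. indicator F y * a y)"
    unfolding integral_restrict_space[OF \<Omega>'] using F(2)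
    by (intro Bochner_Integration.integral_cong) (auto simp: indicator_def)
  also have "\<dots> = (LINT y|lborel. indicator F y * a y)" by (intro integral_completion) measurable
  finally show ?thesis .
qed

lemma weak_solution_measurable:
  "weak_solution \<Omega> A b c d f u \<Longrightarrow> u \<in> borel_measurable (lebesgue_on \<Omega>)"
  unfolding weak_solution_def W12_0_def W12_def Lp_on_def by auto

theorem proposition6p13:
  fixes \<Omega> :: "(real^'n) set"
    and A :: "real^'n \<Rightarrow> real^'n^'n"
    and b c :: "real^'n \<Rightarrow> real^'n"
    and d :: "real^'n \<Rightarrow> real"
    and l p :: real
    and G g :: "real^'n \<Rightarrow> real^'n \<Rightarrow> real"
  assumes "3 \<le> CARD('n)"
    and "open \<Omega>" and "connected \<Omega>" and "emeasure lebesgue \<Omega> < \<infinity>"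
    and "A \<in> borel_measurable (lebesgue_on \<Omega>)" and "bounded (A ` \<Omega>)"
    and "0 < l" and "uniformly_elliptic \<Omega> l A"
    and "Lp_on \<Omega> (real CARD('n)) b" and "Lp_on \<Omega> (real CARD('n)) c"
    and "real CARD('n) < p" and "Lp_on \<Omega> p (\<lambda>x. b x - c x)"
    and "Lp_on \<Omega> (real CARD('n) / 2) d"
    and "ge_div \<Omega> d b"
    and "green_function \<Omega> A b c d G"
    and "green_function \<Omega> (\<lambda>x. transpose (A x)) c b d g"
  shows "AE (x, y) in lebesgue_on (\<Omega> \<times> \<Omega>). x \<noteq> y \<longrightarrow> G x y = g y x"
proof -
  let ?M = "lebesgue_on \<Omega>"
  obtain h K C where L: "drift_form \<Omega> A b c d h K C"
    and LT: "drift_form \<Omega> (\<lambda>x. transpose (A x)) c b d h K C"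
    using drift_form_of_coefficients[OF assms(1,2,4,5,6,9,10,13)] .
  have \<Omega>b: "\<Omega> \<in> sets borel" and \<Omega>l: "\<Omega> \<inter> space lebesgue \<in> sets lebesgue" using assms(2) by auto
  have fin: "emeasure lborel \<Omega> < \<infinity>" using assms(2,4) by (simp add: emeasure_completion)
  have Gk: "(\<lambda>(x, y). G x y) \<in> borel_measurable (lebesgue_on (\<Omega> \<times> \<Omega>))" "AE y in ?M. integrable ?M (\<lambda>x. G x y)"
    and Gsol: "\<And>\<phi>. Linf_on \<Omega> \<phi> \<Longrightarrow> \<exists>u. weak_solution \<Omega> (\<lambda>x. transpose (A x)) c b d \<phi> u \<and>
      (AE y in ?M. u y = (LINT x|?M. G x y * \<phi> x))"
    using assms(15) unfolding green_function_def by blast+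
  have gk: "(\<lambda>(x, y). g x y) \<in> borel_measurable (lebesgue_on (\<Omega> \<times> \<Omega>))" "AE y in ?M. integrable ?M (\<lambda>x. g x y)"
    and gsol: "\<And>\<phi>. Linf_on \<Omega> \<phi> \<Longrightarrow> \<exists>v. weak_solution \<Omega> A b c d \<phi> v \<and>
      (AE y in ?M. v y = (LINT x|?M. g x y * \<phi> x))"
    using assms(16) unfolding green_function_def transpose_transpose by blast+
  obtain G' where G'[measurable]: "G' \<in> borel_measurable borel"
    and G'eq: "AE z in lborel. z \<in> \<Omega> \<times> \<Omega> \<longrightarrow> G' z = G (fst z) (snd z)"
    and G'int: "AE y in lborel. integrable lborel (\<lambda>x. G' (x, y))"
    and G'E: "AE y in lborel. y \<in> \<Omega> \<longrightarrow> (\<forall>E\<in>sets borel. (LINT x|?M. G x y * indicator E x) = (LINT x|lborel. G' (x, y) * indicator E x))"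
    by (rule kernel_borel_representative[OF \<Omega>b \<Omega>b Gk])
  obtain g' where g'[measurable]: "g' \<in> borel_measurable borel"
    and g'eq: "AE z in lborel. z \<in> \<Omega> \<times> \<Omega> \<longrightarrow> g' z = g (fst z) (snd z)"
    and g'int: "AE y in lborel. integrable lborel (\<lambda>x. g' (x, y))"
    and g'E: "AE y in lborel. y \<in> \<Omega> \<longrightarrow> (\<forall>E\<in>sets borel. (LINT x|?M. g x y * indicator E x) = (LINT x|lborel. g' (x, y) * indicator E x))"
    by (rule kernel_borel_representative[OF \<Omega>b \<Omega>b gk])
  \<comment> \<open>\<open>H (x, y)\<close> represents \<open>g y x\<close>\<close>
  define H where "H z = g' (snd z, fst z)" for z
  have Gp[measurable]: "G' \<in> borel_measurable (lborel \<Otimes>\<^sub>M lborel)" "H \<in> borel_measurable (lborel \<Otimes>\<^sub>M lborel)"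
  proof -
    have "(\<lambda>z. (snd z, fst z)) \<in> borel_measurable (borel :: ((real^'n) \<times> (real^'n)) measure)"
      by (intro borel_measurable_continuous_onI continuous_intros)
    from measurable_compose[OF this g'] have "H \<in> borel_measurable borel" by (simp add: H_def[abs_def])
    then show "G' \<in> borel_measurable (lborel \<Otimes>\<^sub>M lborel)" "H \<in> borel_measurable (lborel \<Otimes>\<^sub>M lborel)"
      unfolding lborel_prod by auto
  qed
  have "AE z in lborel \<Otimes>\<^sub>M lborel. z \<in> \<Omega> \<times> \<Omega> \<longrightarrow> G' z = H z"
  proof (rule lborel_pair.kernel_AE_eq)
    show "AE x in lborel. integrable lborel (\<lambda>y. H (x, y))" using g'int by (simp add: H_def)
    fix E F :: "(real^'n) set"
    assume "E \<in> sets lborel" "E \<subseteq> \<Omega>" "F \<in> sets lborel" "F \<subseteq> \<Omega>"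
    then have E[measurable]: "E \<in> sets borel" "E \<subseteq> \<Omega>" and F[measurable]: "F \<in> sets borel" "F \<subseteq> \<Omega>" by auto
    \<comment> \<open>the solutions for the data \<open>indicator E\<close> and \<open>indicator F\<close> are the slice integrals over \<open>E\<close> and \<open>F\<close>\<close>
    obtain u where u: "weak_solution \<Omega> (\<lambda>x. transpose (A x)) c b d (indicator E) u"
      "AE y in ?M. u y = (LINT x|?M. G x y * indicator E x)"
      using Gsol[OF Linf_on_indicator[OF E(1)]] by blast
    obtain v where v: "weak_solution \<Omega> A b c d (indicator F) v"
      "AE x in ?M. v x = (LINT y|?M. g y x * indicator F y)"
      using gsol[OF Linf_on_indicator[OF F(1)]] by blast
    have "AE y in ?M. u y = (LINT x|lborel. G' (x, y) * indicator E x)"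
    proof -
      have "AE y in ?M. \<forall>E\<in>sets borel. (LINT x|?M. G x y * indicator E x) = (LINT x|lborel. G' (x, y) * indicator E x)"
        using G'E by (simp add: AE_restrict_space_iff[OF \<Omega>l] AE_completion_iff)
      with u(2) show ?thesis by eventually_elim (use E(1) in simp)
    qed
    then have "(LINT y|?M. indicator F y * u y) = (LINT y|lborel. indicator F y * (LINT x|lborel. G' (x, y) * indicator E x))"
      by (intro integral_lebesgue_on_indicator_AE[OF \<Omega>b F weak_solution_measurable[OF u(1)]]) measurable
    moreover have "AE x in ?M. v x = (LINT y|lborel. H (x, y) * indicator F y)"
    proof -
      have "AE x in ?M. \<forall>F\<in>sets borel. (LINT y|?M. g y x * indicator F y) = (LINT y|lborel. H (x, y) * indicator F y)"
        using g'E by (simp add: AE_restrict_space_iff[OF \<Omega>l] AE_completion_iff H_def)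
      with v(2) show ?thesis by eventually_elim (use F(1) in simp)
    qed
    then have "(LINT x|?M. indicator E x * v x) = (LINT x|lborel. indicator E x * (LINT y|lborel. H (x, y) * indicator F y))"
      by (intro integral_lebesgue_on_indicator_AE[OF \<Omega>b E weak_solution_measurable[OF v(1)]]) measurable
    ultimately show "(LINT y|lborel. indicator F y * (LINT x|lborel. G' (x, y) * indicator E x))
        = (LINT x|lborel. indicator E x * (LINT y|lborel. H (x, y) * indicator F y))"
      using weak_solution_duality[OF L LT v(1) u(1) Linf_on_indicator[OF F(1)] Linf_on_indicator[OF E(1)]]
      by simp
  qed (use G'int \<Omega>b fin in auto)
  then have "AE z in lborel. z \<in> \<Omega> \<times> \<Omega> \<longrightarrow> G' z = H z" unfolding lborel_prod .
  then have "AE z in lborel. z \<in> \<Omega> \<times> \<Omega> \<longrightarrow> G (fst z) (snd z) = g (snd z) (fst z)"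
    using G'eq AE_lborel_swap[OF g'eq] by eventually_elim (auto simp: H_def)
  moreover have "(\<Omega> \<times> \<Omega>) \<inter> space lebesgue \<in> sets lebesgue" using borel_Times[OF \<Omega>b \<Omega>b] by auto
  ultimately show ?thesis
    by (auto simp: AE_restrict_space_iff AE_completion_iff case_prod_beta' elim!: eventually_mono)
qed

end
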